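(* For every $\varepsilon\in(0,1)$ the limit $M(\varepsilon\mid\mathrm{MonoReg})=\lim_{N\to\infty}M(\mathcal F_{N,\varepsilon,\mathrm{mono}}\mid\eta^{mono})$ exists and $$M(\varepsilon\mid\mathrm{MonoReg})=\max\Big\{\varepsilon\sum_{\ell\ge1}\pi_\ell\,r(\ell)\;:\;\pi\text{ a probability distribution on }\{1,2,\dots\},\ \sum_{\ell\ge1}\ell\,\pi_\ell=1/\varepsilon\Big\}.$$ Equivalently, $M(\varepsilon\mid\mathrm{MonoReg})/\varepsilon=\hat r(1/\varepsilon)$, where $\hat r$ is the least concave majorant on $[1,\infty)$ of the point set $\{(\ell,r(\ell)):\ell\in\mathbb N\}$. Furthermore, there exists $\varepsilon_0>0$ such that $M(\varepsilon\mid\mathrm{MonoReg})\le20\,\varepsilon\,(\log(1/\varepsilon))^2$ for all $\varepsilon\in(0,\varepsilon_0]$.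
   Context: $\mathcal M_N=\{x\in\mathbb R^N:x_{t+1}\ge x_t\ \forall t\le N-1\}$; $\eta^{mono}(y)=\arg\min_{x\in\mathcal M_N}\|y-x\|_2^2$; $r(\ell)=\mathbb E\|\eta^{mono}(\mathbf Z)\|_2^2$ with $\mathbf Z\sim\mathsf N(0,I_{\ell\times\ell})$. The class of mostly-constant nondecreasing signals is $$\mathcal F_{N,\varepsilon,\mathrm{mono}}=\{\nu_N\in\mathcal P(\mathbb R^N):\mathrm{supp}(\nu_N)\subseteq\mathcal M_N,\ \mathbb E_{\nu_N}[\#\{t\in\{1,\dots,N-1\}:X_{t+1}>X_t\}]\le N\varepsilon\},$$ and $M(\mathcal F_{N,\varepsilon,\mathrm{mono}}\mid\eta^{mono})=\frac1N\sup_{\nu_N\in\mathcal F_{N,\varepsilon,\mathrm{mono}}}\mathbb E_{\nu_N}\|\mathbf X-\eta^{mono}(\mathbf X+\mathbf Z)\|_2^2$, with $\mathbf X\sim\nu_N$ independent of $\mathbf Z\sim\mathsf N(0,I_{N\times N})$. *)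

theory Defs
  imports "HOL-Probability.Probability"
begin

text \<open>Vectors in R^N are represented as extensional functions nat => real on the
index set {..<N} (coordinates 0..N-1), i.e. elements of the space of the product
measure PiM {..<N} (%_. lborel).\<close>

definition sqnorm :: "nat \<Rightarrow> (nat \<Rightarrow> real) \<Rightarrow> real" where
  "sqnorm N x = (\<Sum>t<N. (x t)\<^sup>2)"

definition mono_cone :: "nat \<Rightarrow> (nat \<Rightarrow> real) set" where
  "mono_cone N = {x \<in> {..<N} \<rightarrow>\<^sub>E UNIV. \<forall>t. Suc t < N \<longrightarrow> x t \<le> x (Suc t)}"

text \<open>Isotonic regression: Euclidean projection onto M_N (the argmin is unique).\<close>
definition eta_mono :: "nat \<Rightarrow> (nat \<Rightarrow> real) \<Rightarrow> (nat \<Rightarrow> real)" where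
  "eta_mono N y = (THE x. x \<in> mono_cone N \<and>
      (\<forall>z \<in> mono_cone N. sqnorm N (\<lambda>t. y t - x t) \<le> sqnorm N (\<lambda>t. y t - z t)))"

definition vec_space :: "nat \<Rightarrow> (nat \<Rightarrow> real) measure" where
  "vec_space N = PiM {..<N} (\<lambda>_. lborel)"

definition gauss :: "nat \<Rightarrow> (nat \<Rightarrow> real) measure" where
  "gauss N = PiM {..<N} (\<lambda>_. density lborel std_normal_density)"

definition r_mono :: "nat \<Rightarrow> real" where
  "r_mono l = (\<integral>z. sqnorm l (eta_mono l z) \<partial>gauss l)"

text \<open>Number of jumps #{t in {1..N-1} : x_(t+1) > x_t} (0-based indices here).\<close>
definition njumps :: "nat \<Rightarrow> (nat \<Rightarrow> real) \<Rightarrow> nat" where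
  "njumps N x = card {t. Suc t < N \<and> x t < x (Suc t)}"

definition F_mono :: "nat \<Rightarrow> real \<Rightarrow> (nat \<Rightarrow> real) measure set" where
  "F_mono N \<epsilon> = {\<nu>. prob_space \<nu> \<and> sets \<nu> = sets (vec_space N) \<and>
      (AE x in \<nu>. x \<in> mono_cone N) \<and>
      (\<integral>\<^sup>+ x. ennreal (real (njumps N x)) \<partial>\<nu>) \<le> ennreal (real N * \<epsilon>)}"

definition risk_mono :: "nat \<Rightarrow> (nat \<Rightarrow> real) measure \<Rightarrow> ennreal" where
  "risk_mono N \<nu> = (\<integral>\<^sup>+ xz. ennreal (sqnorm N (\<lambda>t. fst xz t -
        eta_mono N (\<lambda>s. fst xz s + snd xz s) t)) \<partial>(\<nu> \<Otimes>\<^sub>M gauss N))"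

definition minimax_mono :: "nat \<Rightarrow> real \<Rightarrow> ennreal" where
  "minimax_mono N \<epsilon> = (SUP \<nu> \<in> F_mono N \<epsilon>. risk_mono N \<nu>) / ennreal (real N)"

definition feasible_pi :: "real \<Rightarrow> (nat \<Rightarrow> real) \<Rightarrow> bool" where
  "feasible_pi \<epsilon> \<pi> \<longleftrightarrow> (\<forall>l. 0 \<le> \<pi> l) \<and> \<pi> 0 = 0 \<and> \<pi> sums 1 \<and>
      (\<lambda>l. real l * \<pi> l) sums (1 / \<epsilon>)"

definition r_hat :: "real \<Rightarrow> real" where
  "r_hat x = Inf {g x | g. concave_on {1..} g \<and> (\<forall>l::nat. 1 \<le> l \<longrightarrow> r_mono l \<le> g (real l))}"

end

theory Submission
  imports Defs
begin

text \<open>Everything rests on the identity \<open>r(l) = 1 + 1/2 + \<dots> + 1/l\<close>. The partial sums of the isotonic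
  regression of \<open>z\<close> are the greatest convex minorant of the partial sums of \<open>z\<close>, so the sum of the
  positive parts of \<open>c - \<eta>(z)\<^sub>t\<close> is the maximal partial sum of \<open>c - z\<close>. Dyson's lemma on cyclic
  shifts evaluates the increments of this maximum; integrating over \<open>c\<close> turns positive parts into
  squares and gives \<open>r(k) = r(k-1) + 1/k\<close>.

  Since \<open>r\<close> is concave, with \<open>m = \<lfloor>1/\<epsilon>\<rfloor>\<close> the chord \<open>\<alpha> + \<beta> l\<close> through \<open>(m, r(m))\<close> and
  \<open>(m+1, r(m+1))\<close> majorizes \<open>r\<close>. The error at a signal with \<open>k\<close> constant pieces is at most the sum of
  \<open>r\<close> over the piece lengths, because the projection onto a convex set is no longer than the
  projection onto its tangent cone; hence the risk is at most \<open>\<alpha> k + \<beta> N\<close>. This is asymptotically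
  attained by \<open>\<lfloor>N \<epsilon>\<rfloor>\<close> pieces of lengths \<open>m\<close> and \<open>m+1\<close> whose jump heights tend to infinity. So the
  limit is \<open>\<alpha> \<epsilon> + \<beta>\<close>.\<close>

section \<open>Isotonic regression as a projection\<close>

text \<open>Monotonicity is kept apart from membership in \<open>mono_cone\<close>, so that sums,
  shifts and blocks of vectors need no restriction to \<open>{..<N}\<close>.\<close>

definition nondecr :: "nat \<Rightarrow> (nat \<Rightarrow> real) \<Rightarrow> bool" where
  "nondecr N u \<longleftrightarrow> (\<forall>t. Suc t < N \<longrightarrow> u t \<le> u (Suc t))"

lemma mono_cone_iff: "x \<in> mono_cone N \<longleftrightarrow> x \<in> extensional {..<N} \<and> nondecr N x"
  by (auto simp: mono_cone_def nondecr_def PiE_def)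

lemma nondecr_le:
  assumes "nondecr N u" "s \<le> t" "t < N"
  shows "u s \<le> u t"
  using assms(2,3)
proof (induction t rule: dec_induct)
  case (step t)
  then show ?case using assms(1) by (force simp: nondecr_def)
qed simp

lemma restrict_in_mono_cone: "nondecr N u \<Longrightarrow> restrict u {..<N} \<in> mono_cone N"
  by (auto simp: mono_cone_iff nondecr_def)

lemma sqnorm_restrict_diff:
  "sqnorm N (\<lambda>t. y t - restrict u {..<N} t) = sqnorm N (\<lambda>t. y t - u t)"
  by (simp add: sqnorm_def)

lemma sqnorm_nonneg: "0 \<le> sqnorm N x"
  by (simp add: sqnorm_def sum_nonneg)

lemma le_sqnorm: "t < N \<Longrightarrow> (x t)\<^sup>2 \<le> sqnorm N x"
  unfolding sqnorm_def by (rule member_le_sum[where f="\<lambda>t. (x t)\<^sup>2"]) auto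

text \<open>A continuous objective attains its minimum on a compact part of the cone, and cone
  vectors outside that part do no better than the zero vector.\<close>

lemma mono_cone_minimizer_exists:
  "\<exists>x \<in> mono_cone N. \<forall>z \<in> mono_cone N. sqnorm N (\<lambda>t. y t - x t) \<le> sqnorm N (\<lambda>t. y t - z t)"
proof -
  \<comment> \<open>If \<open>z t\<close> lies outside \<open>{-R..R}\<close>, its distance from
    \<open>y t\<close> is at least the norm of \<open>y\<close>, which is the error of the zero
    vector.\<close>
  define R where "R = 2 * sqrt (sqnorm N y)"
  \<comment> \<open>From \<open>N\<close> on every coordinate is pinned to \<open>undefined\<close>:
    the infinite product stays compact and its points are extensional.\<close>
  define B where "B = (\<lambda>i. if i < N then {-R..R} else {undefined::real})"
  define C where "C = PiE UNIV B \<inter> {x. nondecr N x}"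
  have "compactin (product_topology (\<lambda>i::nat. euclideanreal) UNIV) (PiE UNIV B)"
    by (subst compactin_PiE) (auto simp: B_def)
  then have "compact (PiE UNIV B)"
    by (simp add: euclidean_product_topology)
  moreover have "closed {x. nondecr N x}"
    unfolding nondecr_def imp_conv_disj
    by (intro closed_Collect_all closed_Collect_disj closed_Collect_le)
       (auto intro: continuous_on_product_coordinates)
  ultimately have cC: "compact C"
    unfolding C_def by (rule compact_Int_closed)
  have R0: "R \<ge> 0" by (simp add: R_def sqnorm_nonneg)
  define o0 where "o0 = restrict (\<lambda>_. 0::real) {..<N}"
  have "o0 \<in> C" using R0 by (auto simp: C_def B_def o0_def nondecr_def)
  then have ne: "C \<noteq> {}" by auto
  have "continuous_on C (\<lambda>x. sqnorm N (\<lambda>t. y t - x t))"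
    unfolding sqnorm_def
    by (intro continuous_intros continuous_on_product_coordinates[THEN continuous_on_subset]) auto
  from continuous_attains_inf[OF cC ne this] obtain x where x: "x \<in> C"
    and xmin: "\<And>z. z \<in> C \<Longrightarrow> sqnorm N (\<lambda>t. y t - x t) \<le> sqnorm N (\<lambda>t. y t - z t)" by auto
  show ?thesis
  proof (intro bexI ballI)
    show "x \<in> mono_cone N" using x
      by (force simp: C_def B_def mono_cone_iff extensional_def PiE_iff split: if_splits)
    fix z assume z: "z \<in> mono_cone N"
    show "sqnorm N (\<lambda>t. y t - x t) \<le> sqnorm N (\<lambda>t. y t - z t)"
    proof (cases "z \<in> C")
      case False
      then have "z \<notin> PiE UNIV B" using z by (auto simp: C_def mono_cone_iff)
      then obtain t where "z t \<notin> B t" by auto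
      then have t: "t < N" "z t \<notin> {-R..R}"
        using z by (auto simp: B_def mono_cone_iff extensional_def split: if_splits)
      have "\<bar>y t\<bar> \<le> sqrt (sqnorm N y)"
        using le_sqnorm[OF t(1), of y] real_le_rsqrt[of "\<bar>y t\<bar>"] by simp
      then have "sqrt (sqnorm N y) \<le> \<bar>y t - z t\<bar>"
        using t(2) by (auto simp: R_def)
      then have "sqnorm N y \<le> (y t - z t)\<^sup>2"
        by (metis abs_ge_zero power2_abs real_sqrt_le_iff real_sqrt_abs)
      also have "\<dots> \<le> sqnorm N (\<lambda>t. y t - z t)" by (rule le_sqnorm[OF t(1)])
      also have "sqnorm N y = sqnorm N (\<lambda>t. y t - o0 t)"
        by (simp add: o0_def sqnorm_def)
      finally show ?thesis using xmin[OF \<open>o0 \<in> C\<close>] by simp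
    qed (rule xmin)
  qed
qed

section \<open>Variational characterization of the projection\<close>

lemma sqnorm_diff_expand:
  "sqnorm N (\<lambda>t. y t - v t) = sqnorm N (\<lambda>t. y t - x t)
     - 2 * (\<Sum>t<N. (y t - x t) * (v t - x t)) + sqnorm N (\<lambda>t. v t - x t)"
  unfolding sqnorm_def sum_distrib_left sum.distrib[symmetric] sum_subtractf[symmetric]
  by (intro sum.cong refl) (simp add: power2_eq_square algebra_simps)

text \<open>Expanding around \<open>u\<close>, the error of a competitor \<open>z\<close> exceeds
  that of \<open>u\<close> by at least the squared distance between \<open>z\<close> and
  \<open>u\<close>. This gives minimality and uniqueness at once.\<close>

lemma eta_mono_eqI:
  assumes u: "nondecr N u"
    and var: "\<And>v. nondecr N v \<Longrightarrow> (\<Sum>t<N. (y t - u t) * (v t - u t)) \<le> 0"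
  shows "eta_mono N y = restrict u {..<N}"
  unfolding eta_mono_def
proof (rule the_equality)
  have *: "sqnorm N (\<lambda>t. y t - u t) + sqnorm N (\<lambda>t. z t - u t) \<le> sqnorm N (\<lambda>t. y t - z t)"
    if "z \<in> mono_cone N" for z
    using var[of z] that by (simp add: mono_cone_iff sqnorm_diff_expand[of N y z u])
  show "restrict u {..<N} \<in> mono_cone N \<and> (\<forall>z\<in>mono_cone N.
     sqnorm N (\<lambda>t. y t - restrict u {..<N} t) \<le> sqnorm N (\<lambda>t. y t - z t))"
    unfolding sqnorm_restrict_diff
  proof (intro conjI ballI)
    show "restrict u {..<N} \<in> mono_cone N" by (rule restrict_in_mono_cone[OF u])
    show "sqnorm N (\<lambda>t. y t - u t) \<le> sqnorm N (\<lambda>t. y t - z t)" if "z \<in> mono_cone N" for z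
      using *[OF that] sqnorm_nonneg[of N "\<lambda>t. z t - u t"] by linarith
  qed
  fix x assume x: "x \<in> mono_cone N \<and>
    (\<forall>z\<in>mono_cone N. sqnorm N (\<lambda>t. y t - x t) \<le> sqnorm N (\<lambda>t. y t - z t))"
  then have "sqnorm N (\<lambda>t. y t - x t) \<le> sqnorm N (\<lambda>t. y t - u t)"
    using restrict_in_mono_cone[OF u] sqnorm_restrict_diff by metis
  with *[of x] x have "sqnorm N (\<lambda>t. x t - u t) \<le> 0" by simp
  then have "x t = u t" if "t < N" for t
    using le_sqnorm[OF that, of "\<lambda>t. x t - u t"]
    by (smt (verit) power2_less_eq_zero_iff)
  then show "x = restrict u {..<N}"
    using x by (auto simp: mono_cone_iff extensional_def)
qed

text \<open>By convexity a step of size \<open>h\<close> from \<open>x\<close> towards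
  \<open>v\<close> stays in the cone. Minimality bounds the first-order gain by a second-order term,
  and \<open>h\<close> can be made small.\<close>

lemma variational_inequality_of_minimizer:
  assumes x: "nondecr N x" and v: "nondecr N v"
    and min: "\<And>z. z \<in> mono_cone N \<Longrightarrow> sqnorm N (\<lambda>t. y t - x t) \<le> sqnorm N (\<lambda>t. y t - z t)"
  shows "(\<Sum>t<N. (y t - x t) * (v t - x t)) \<le> 0"
proof -
  let ?a = "\<Sum>t<N. (y t - x t) * (v t - x t)" and ?b = "sqnorm N (\<lambda>t. v t - x t)"
  have h: "2 * ?a \<le> h * ?b" if h: "0 < h" "h \<le> 1" for h
  proof -
    let ?w = "\<lambda>t. x t + h * (v t - x t)"
    have "nondecr N ?w" unfolding nondecr_def
    proof (intro allI impI)
      fix t assume "Suc t < N"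
      then have "x t \<le> x (Suc t)" "v t \<le> v (Suc t)" using x v by (auto simp: nondecr_def)
      then have "(1 - h) * x t + h * v t \<le> (1 - h) * x (Suc t) + h * v (Suc t)"
        using h by (intro add_mono mult_left_mono) auto
      then show "?w t \<le> ?w (Suc t)" by (simp add: algebra_simps)
    qed
    from min[OF restrict_in_mono_cone[OF this], unfolded sqnorm_restrict_diff]
    have "0 \<le> - 2 * (\<Sum>t<N. (y t - x t) * (?w t - x t)) + sqnorm N (\<lambda>t. ?w t - x t)"
      by (simp add: sqnorm_diff_expand[of N y ?w x])
    also have "\<dots> = h * (h * ?b - 2 * ?a)"
      unfolding sqnorm_def sum_distrib_left sum.distrib[symmetric] sum_subtractf[symmetric]
      by (intro sum.cong refl) (simp add: power2_eq_square algebra_simps)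
    finally show ?thesis using h by (simp add: zero_le_mult_iff)
  qed
  show ?thesis
  proof (rule ccontr)
    assume "\<not> ?a \<le> 0"
    then have a: "?a > 0" by simp
    \<comment> \<open>This choice gives \<open>h * (?b + 1) \<le> ?a\<close>, contradicting
      \<open>2 * ?a \<le> h * ?b\<close>; the summand 1 guards against
      \<open>?b = 0\<close>.\<close>
    define h where "h = min 1 (?a / (?b + 1))"
    have b: "?b \<ge> 0" by (rule sqnorm_nonneg)
    have "h \<le> ?a / (?b + 1)" by (simp add: h_def)
    then have "h * (?b + 1) \<le> ?a" using b by (simp add: pos_le_divide_eq)
    moreover have "0 < h" "h \<le> 1" using a b by (auto simp: h_def)
    ultimately show False using h[of h] a by (simp add: algebra_simps)
  qed
qed

lemma
  shows nondecr_eta_mono: "nondecr N (eta_mono N y)"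
    and eta_mono_variational:
      "nondecr N v \<Longrightarrow> (\<Sum>t<N. (y t - eta_mono N y t) * (v t - eta_mono N y t)) \<le> 0"
proof -
  obtain x where x: "x \<in> mono_cone N"
    and min: "\<And>z. z \<in> mono_cone N \<Longrightarrow> sqnorm N (\<lambda>t. y t - x t) \<le> sqnorm N (\<lambda>t. y t - z t)"
    using mono_cone_minimizer_exists by blast
  have nx: "nondecr N x" using x by (simp add: mono_cone_iff)
  \<comment> \<open>The minimizer found by compactness satisfies the variational inequality, so it
    is the vector selected by \<open>THE\<close>.\<close>
  have "eta_mono N y = restrict x {..<N}"
    by (rule eta_mono_eqI[OF nx variational_inequality_of_minimizer[OF nx _ min]])
  also have "\<dots> = x" using x by (simp add: mono_cone_iff extensional_restrict)
  finally have eq: "eta_mono N y = x" .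
  show "nondecr N (eta_mono N y)"
    using nx by (simp add: eq)
  show "nondecr N v \<Longrightarrow> (\<Sum>t<N. (y t - eta_mono N y t) * (v t - eta_mono N y t)) \<le> 0"
    unfolding eq by (rule variational_inequality_of_minimizer[OF nx _ min])
qed

text \<open>The cone is closed under addition, so the projection plus \<open>u\<close> is an
  admissible test vector: the residual lies in the polar cone.\<close>

lemma eta_mono_residual_polar:
  assumes "nondecr N u"
  shows "(\<Sum>t<N. (y t - eta_mono N y t) * u t) \<le> 0"
proof -
  have "nondecr N (\<lambda>t. eta_mono N y t + u t)"
    using nondecr_eta_mono[of N y] assms by (force simp: nondecr_def)
  from eta_mono_variational[OF this, where y=y] show ?thesis by simp
qed

section \<open>Dependence of the projection on the data\<close>

lemma eta_mono_cong:
  assumes "\<And>t. t < N \<Longrightarrow> y t = y' t"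
  shows "eta_mono N y = eta_mono N y'"
proof -
  have "sqnorm N (\<lambda>t. y t - x t) = sqnorm N (\<lambda>t. y' t - x t)" for x
    using assms by (simp add: sqnorm_def)
  then show ?thesis by (simp add: eta_mono_def)
qed

text \<open>Expanding the squares leaves two cross terms; each is the variational inequality of one
  projection tested at the other. Nonexpansiveness then yields continuity and measurability.\<close>

lemma sqnorm_eta_mono_diff_le:
  "sqnorm N (\<lambda>t. eta_mono N y t - eta_mono N y' t) \<le> sqnorm N (\<lambda>t. y t - y' t)"
proof -
  let ?p = "eta_mono N y" and ?q = "eta_mono N y'"
  have "sqnorm N (\<lambda>t. ?p t - ?q t) + sqnorm N (\<lambda>t. (y t - y' t) - (?p t - ?q t))
     = sqnorm N (\<lambda>t. y t - y' t) + 2 * (\<Sum>t<N. (y t - ?p t) * (?q t - ?p t))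
       + 2 * (\<Sum>t<N. (y' t - ?q t) * (?p t - ?q t))"
    unfolding sqnorm_def sum_distrib_left sum.distrib[symmetric]
    by (intro sum.cong refl) (simp add: power2_eq_square algebra_simps)
  then show ?thesis
    using eta_mono_variational[OF nondecr_eta_mono[of N y'], of y] eta_mono_variational[OF nondecr_eta_mono[of N y], of y']
      sqnorm_nonneg[of N "\<lambda>t. (y t - y' t) - (?p t - ?q t)"] by linarith
qed

lemma continuous_eta_mono:
  "t < N \<Longrightarrow> continuous_on UNIV (\<lambda>y. eta_mono N y t)"
  unfolding continuous_on_eq_continuous_at[OF open_UNIV] isCont_def
proof
  fix y :: "nat \<Rightarrow> real" assume t: "t < N"
  have lim: "((\<lambda>y'. sqrt (sqnorm N (\<lambda>t. y' t - y t))) \<longlongrightarrow> sqrt (sqnorm N (\<lambda>t. y t - y t))) (at y)"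
    unfolding sqnorm_def
    by (intro tendsto_intros continuous_on_product_coordinates[THEN continuous_on_subset, unfolded continuous_on_def, rule_format]) auto
  have "((\<lambda>y'. eta_mono N y' t - eta_mono N y t) \<longlongrightarrow> 0) (at y)"
  proof (rule Lim_null_comparison)
    show "\<forall>\<^sub>F y' in at y. norm (eta_mono N y' t - eta_mono N y t) \<le> sqrt (sqnorm N (\<lambda>t. y' t - y t))"
      using order_trans[OF le_sqnorm[OF t, of "\<lambda>t. eta_mono N y' t - eta_mono N y t" for y'] sqnorm_eta_mono_diff_le]
      by (intro always_eventually allI real_le_rsqrt) simp
  qed (use lim in \<open>simp add: sqnorm_def\<close>)
  then show "((\<lambda>y. eta_mono N y t) \<longlongrightarrow> eta_mono N y t) (at y)"
    by (simp add: LIM_zero_iff)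
qed

lemma eta_mono_measurable:
  assumes "\<And>s. s < N \<Longrightarrow> (\<lambda>\<omega>. f \<omega> s) \<in> borel_measurable M" and t: "t < N"
  shows "(\<lambda>\<omega>. eta_mono N (f \<omega>) t) \<in> borel_measurable M"
proof -
  \<comment> \<open>Filling the coordinates from \<open>N\<close> on with 0 gives a measurable map
    into the full sequence space, where continuity of the projection is available.\<close>
  have *: "(\<lambda>\<omega>. if s < N then f \<omega> s else 0) \<in> borel_measurable M" for s
    using assms(1)[of s] by (cases "s < N") auto
  have "(\<lambda>\<omega>. eta_mono N (\<lambda>s. if s < N then f \<omega> s else 0) t) \<in> borel_measurable M"
    by (rule measurable_compose[OF measurable_coordinatewise_then_product
          borel_measurable_continuous_onI[OF continuous_eta_mono[OF t]]]) (rule *)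
  also have "(\<lambda>\<omega>. eta_mono N (\<lambda>s. if s < N then f \<omega> s else 0) t) = (\<lambda>\<omega>. eta_mono N (f \<omega>) t)"
    using eta_mono_cong[of N "\<lambda>s. if s < N then f \<omega> s else 0" "f \<omega>" for \<omega>] by simp
  finally show ?thesis .
qed

section \<open>Maximal partial sums and cyclic shifts\<close>

definition max_prefix :: "nat \<Rightarrow> (nat \<Rightarrow> real) \<Rightarrow> real" where
  "max_prefix n y = Max ((\<lambda>t. \<Sum>i<t. y i) ` {..n})"

lemma max_prefix_eqI:
  assumes "\<And>t. t \<le> n \<Longrightarrow> (\<Sum>i<t. y i) \<le> c" "s \<le> n" "(\<Sum>i<s. y i) = c"
  shows "max_prefix n y = c"
  unfolding max_prefix_def using assms by (intro Max_eqI) auto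

text \<open>Polarity is tested with minus the indicator of the first \<open>t\<close> indices, a
  nondecreasing vector.\<close>

lemma eta_mono_partial_sum_le:
  assumes "t \<le> N"
  shows "(\<Sum>i<t. eta_mono N y i) \<le> (\<Sum>i<t. y i)"
proof -
  have "nondecr N (\<lambda>i. if i < t then -1 else 0)" by (auto simp: nondecr_def)
  from eta_mono_residual_polar[OF this, of y]
  have "(\<Sum>i<N. if i < t then eta_mono N y i - y i else 0) \<le> 0"
    by (simp add: if_distrib mult.commute cong: if_cong)
  also have "(\<Sum>i<N. if i < t then eta_mono N y i - y i else 0) = (\<Sum>i<t. eta_mono N y i - y i)"
    using assms by (intro sum.mono_neutral_cong_right) auto
  finally show ?thesis by (simp add: sum_subtractf)
qed

lemma sum_eta_mono: "(\<Sum>i<N. eta_mono N y i) = (\<Sum>i<N. y i)"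
proof -
  have "nondecr N (\<lambda>_. 1)" by (simp add: nondecr_def)
  from eta_mono_residual_polar[OF this, of y] eta_mono_partial_sum_le[of N N y]
  show ?thesis by (simp add: sum_subtractf)
qed

text \<open>At a jump all entries to its left can be raised by the jump height without leaving the
  cone. Testing with this vector reverses the partial sum inequality.\<close>

lemma eta_mono_partial_sum_eq_at_jump:
  assumes t: "Suc t < N" and jump: "eta_mono N y t < eta_mono N y (Suc t)"
  shows "(\<Sum>i<Suc t. eta_mono N y i) = (\<Sum>i<Suc t. y i)"
proof -
  let ?p = "eta_mono N y"
  define h where "h = ?p (Suc t) - ?p t"
  have h: "h > 0" using jump by (simp add: h_def)
  have "nondecr N (\<lambda>i. ?p i + (if i < Suc t then h else 0))"
    unfolding nondecr_def
  proof (intro allI impI)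
    fix i assume "Suc i < N"
    then have "?p i \<le> ?p (Suc i)" using nondecr_eta_mono[of N y] by (simp add: nondecr_def)
    then show "?p i + (if i < Suc t then h else 0) \<le> ?p (Suc i) + (if Suc i < Suc t then h else 0)"
      using h by (cases "i = t") (auto simp: h_def)
  qed
  from eta_mono_variational[OF this, of y]
  have "(\<Sum>i<N. if i < Suc t then h * (y i - ?p i) else 0) \<le> 0"
    by (simp add: if_distrib[of "\<lambda>x. _ * x"] mult.commute cong: if_cong)
  also have "(\<Sum>i<N. if i < Suc t then h * (y i - ?p i) else 0) = (\<Sum>i<Suc t. h * (y i - ?p i))"
    using t by (intro sum.mono_neutral_cong_right) auto
  finally have "(\<Sum>i<Suc t. y i - ?p i) \<le> 0"
    using h by (simp only: sum_distrib_left[symmetric] mult_le_0_iff) auto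
  then show ?thesis using eta_mono_partial_sum_le[of "Suc t" N y] t
    by (simp only: sum_subtractf) linarith
qed

text \<open>The partial sums of the projection form the greatest convex minorant of the partial sums
  of the data, so the two have the same Legendre transform.\<close>

lemma sum_pos_part_eta_mono:
  "(\<Sum>t<N. max 0 (c - eta_mono N y t)) = max_prefix N (\<lambda>t. c - y t)"
proof -
  let ?p = "eta_mono N y"
  \<comment> \<open>\<open>T\<close> is the first index where the projection reaches
    \<open>c\<close>, or \<open>N\<close> if there is none. The terms \<open>c - ?p i\<close> are
    positive before \<open>T\<close> and at most 0 from \<open>T\<close> on, so the prefix of length
    \<open>T\<close> is the maximal one.\<close>
  define T where "T = (LEAST t. t = N \<or> c \<le> ?p t)"
  have T: "T = N \<or> c \<le> ?p T" unfolding T_def by (rule LeastI[of _ N]) simp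
  have TN: "T \<le> N" unfolding T_def by (rule Least_le) simp
  have below: "?p i < c" if "i < T" for i
    using not_less_Least[OF that[unfolded T_def]] by auto
  have above: "c \<le> ?p i" if "T \<le> i" "i < N" for i
    using T nondecr_le[OF nondecr_eta_mono that, of y] that by auto
  \<comment> \<open>Data and projection have equal sums up to \<open>T\<close> because
    \<open>T\<close> is 0, \<open>N\<close> or the position right after a jump.\<close>
  have eqT: "(\<Sum>i<T. ?p i) = (\<Sum>i<T. y i)"
  proof (cases "T = 0 \<or> T = N")
    case True
    then show ?thesis using sum_eta_mono by auto
  next
    case False
    then obtain t where "T = Suc t" by (cases T) auto
    then show ?thesis
      using eta_mono_partial_sum_eq_at_jump[of t N y] below[of t] above[of T] False TN by auto
  qed
  have "max_prefix N (\<lambda>t. c - y t) = (\<Sum>t<N. max 0 (c - ?p t))"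
  proof (rule max_prefix_eqI)
    fix t assume t: "t \<le> N"
    have "(\<Sum>i<t. c - y i) \<le> (\<Sum>i<t. c - ?p i)"
      using eta_mono_partial_sum_le[OF t, of y] by (simp add: sum_subtractf)
    also have "\<dots> \<le> (\<Sum>i<t. max 0 (c - ?p i))" by (intro sum_mono) auto
    also have "\<dots> \<le> (\<Sum>i<N. max 0 (c - ?p i))" using t by (intro sum_mono2) auto
    finally show "(\<Sum>i<t. c - y i) \<le> (\<Sum>t<N. max 0 (c - ?p t))" .
  next
    have "(\<Sum>i<T. c - y i) = (\<Sum>i<T. c - ?p i)" by (simp add: sum_subtractf eqT)
    also have "\<dots> = (\<Sum>i<N. max 0 (c - ?p i))"
      using TN by (intro sum.mono_neutral_cong_left) (auto simp: max_def dest: below intro: order_antisym[OF above] less_imp_le)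
    finally show "(\<Sum>i<T. c - y i) = (\<Sum>t<N. max 0 (c - ?p t))" .
  qed (rule TN)
  then show ?thesis ..
qed

text \<open>Dyson's combinatorial lemma. When the total is positive, extend the walk periodically: the
  increments of the running maximum over a window of one period telescope.\<close>

lemma sum_cyclic_max_prefix_increment:
  fixes y :: "nat \<Rightarrow> real"
  assumes k: "k \<ge> 1"
  shows "(\<Sum>s<k. max_prefix k (\<lambda>i. y ((s + i) mod k)) - max_prefix (k - 1) (\<lambda>i. y ((s + i) mod k)))
     = max 0 (\<Sum>i<k. y i)"
proof -
  define W where "W j = (\<Sum>i<j. y (i mod k))" for j
  define S where "S = (\<Sum>i<k. y i)"
  \<comment> \<open>A window of \<open>k\<close> points is what \<open>max_prefix (k - 1)\<close>
    sees, up to subtracting \<open>W s\<close>; \<open>max_prefix k\<close> sees one point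
    more.\<close>
  define G where "G s = Max (W ` {s..<s + k})" for s
  have W_add: "(\<Sum>i<t. y ((s + i) mod k)) = W (s + t) - W s" for s t
    by (induction t) (auto simp: W_def)
  have W_per: "W (j + k) = W j + S" for j
  proof (induction j)
    case 0
    then show ?case by (simp add: W_def S_def)
  next
    case (Suc j)
    then show ?case by (simp add: W_def)
  qed
  have mp: "max_prefix n (\<lambda>i. y ((s + i) mod k)) = Max (W ` {s..s + n}) - W s" for n s
  proof -
    have "(\<lambda>t. W (s + t) - W s) ` {..n} = (\<lambda>x. x - W s) ` W ` {s..s + n}"
      unfolding image_image using image_add_atLeastAtMost'[of s 0 n]
      by (simp add: image_image[of "\<lambda>x. W x - W s" "\<lambda>x. x + s", symmetric] add.commute atMost_atLeast0)
    moreover have "Max (W ` {s..s + n}) - W s = Max ((\<lambda>x. x - W s) ` W ` {s..s + n})"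
      by (rule mono_Max_commute) (auto simp: mono_def)
    ultimately show ?thesis by (simp add: max_prefix_def W_add)
  qed
  have le_G: "W j \<le> G s" if "s \<le> j" "j < s + k" for j s
    unfolding G_def using that by (intro Max_ge) auto
  have mp1: "max_prefix (k - 1) (\<lambda>i. y ((s + i) mod k)) = G s - W s" for s
  proof -
    have "{s..s + (k - 1)} = {s..<s + k}" using k by auto
    then show ?thesis by (simp add: mp G_def)
  qed
  show ?thesis
  proof (cases "S \<le> 0")
    case True
    \<comment> \<open>The extra point \<open>W (s + k) = W s + S\<close> does not exceed
      \<open>W s\<close>, so every increment vanishes.\<close>
    have "Max (W ` {s..s + k}) = G s" for s
    proof -
      have "{s..s + k} = insert (s + k) {s..<s + k}" by auto
      then have "Max (W ` {s..s + k}) = max (W (s + k)) (G s)"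
        using k by (simp add: G_def)
      moreover have "W (s + k) \<le> G s" using le_G[of s s] k W_per[of s] True by simp
      ultimately show ?thesis by simp
    qed
    then show ?thesis unfolding mp[of k] mp1 using True by (simp add: S_def)
  next
    case False
    have "Max (W ` {s..s + k}) = G (Suc s)" for s
    proof -
      have "{s..s + k} = insert s {Suc s..<Suc s + k}" by auto
      then have "Max (W ` {s..s + k}) = max (W s) (G (Suc s))"
        using k by (simp add: G_def)
      moreover have "W s \<le> G (Suc s)" using le_G[of "Suc s" "s + k"] k W_per[of s] False by simp
      ultimately show ?thesis by simp
    qed
    then have "(\<Sum>s<k. max_prefix k (\<lambda>i. y ((s + i) mod k)) - max_prefix (k - 1) (\<lambda>i. y ((s + i) mod k)))
      = (\<Sum>s<k. G (Suc s) - G s)" unfolding mp[of k] mp1 by simp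
    also have "\<dots> = G k - G 0" by (rule sum_lessThan_telescope)
    also have "G k = G 0 + S"
    proof -
      have "W ` {k..<k + k} = (\<lambda>x. x + S) ` W ` {0..<0 + k}"
        unfolding image_image W_per[symmetric]
        using image_add_atLeastLessThan'[of k 0 k] image_image[of W "\<lambda>j. j + k" "{0..<k}"] by simp
      moreover have "Max (W ` {0..<0 + k}) + S = Max ((\<lambda>x. x + S) ` W ` {0..<0 + k})"
        using k by (intro mono_Max_commute) (auto simp: mono_def)
      ultimately show ?thesis by (simp add: G_def)
    qed
    finally show ?thesis using False by (simp add: S_def)
  qed
qed

text \<open>Integration over the level \<open>c\<close> is what turns positive parts into squares.
  The interval contains the kink at \<open>q\<close>, so the formula is exact.\<close>

lemma has_integral_pos_part:
  fixes q L :: real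
  assumes "\<bar>q\<bar> \<le> L"
  shows "((\<lambda>c. max 0 (c - q)) has_integral (L - q)\<^sup>2 / 2) {-L..L}"
proof -
  have q: "-L \<le> q" "q \<le> L" using assms by auto
  have "((\<lambda>c. max 0 (c - q)) has_integral 0) {-L..q}"
    by (rule has_integral_is_0) auto
  moreover have "((\<lambda>c. c - q) has_integral ((L - q)\<^sup>2 / 2 - (q - q)\<^sup>2 / 2)) {q..L}"
    using q by (intro fundamental_theorem_of_calculus)
      (auto intro!: derivative_eq_intros simp flip: has_real_derivative_iff_has_vector_derivative)
  then have "((\<lambda>c. max 0 (c - q)) has_integral (L - q)\<^sup>2 / 2) {q..L}"
    by (subst has_integral_cong[where g="\<lambda>c. c - q"]) auto
  ultimately show ?thesis using has_integral_combine[OF q] by fastforce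
qed

lemma sum_mod_shift:
  fixes z :: "nat \<Rightarrow> real"
  assumes "k \<ge> 1"
  shows "(\<Sum>s<k. z ((s + i) mod k)) = (\<Sum>s<k. z s)"
proof (induction i)
  case (Suc i)
  obtain m where m: "k = Suc m" using assms by (cases k) auto
  have "(\<Sum>s<k. z ((s + Suc i) mod k)) = (\<Sum>s<m. z ((Suc s + i) mod k)) + z ((m + Suc i) mod k)"
    by (simp add: m)
  also have "(m + Suc i) mod k = (0 + i) mod k" using mod_add_self1[of "Suc m" i] by (simp add: m)
  also have "(\<Sum>s<m. z ((Suc s + i) mod k)) + z ((0 + i) mod k) = (\<Sum>s<Suc m. z ((s + i) mod k))"
    by (subst sum.lessThan_Suc_shift) simp
  finally show ?case using Suc by (simp add: m)
qed simp

text \<open>Dyson's lemma for \<open>c - z\<close> compares the positive parts of the projections at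
  lengths \<open>k\<close> and \<open>k - 1\<close>, with difference
  \<open>k * max 0 (c - A)\<close> for the mean \<open>A\<close>. Integrating over \<open>c\<close>
  gives squares \<open>(L - p)\<^sup>2\<close>; the terms containing \<open>L\<close>
  cancel.\<close>

lemma sum_cyclic_sqnorm_eta_mono:
  fixes z :: "nat \<Rightarrow> real"
  assumes k: "k \<ge> 1"
  shows "(\<Sum>s<k. sqnorm k (eta_mono k (\<lambda>i. z ((s + i) mod k))))
    = (\<Sum>s<k. sqnorm (k - 1) (eta_mono (k - 1) (\<lambda>i. z ((s + i) mod k)))) + (\<Sum>i<k. z i)\<^sup>2 / k"
proof -
  define sh where "sh s = (\<lambda>i. z ((s + i) mod k))" for s
  define p where "p n s = eta_mono n (sh s)" for n s
  define S where "S = (\<Sum>i<k. z i)"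
  define A where "A = S / k"
  \<comment> \<open>A common bound \<open>L\<close> for the mean and the finitely many projection
    values lets one interval serve all terms.\<close>
  have "bounded (insert A ((\<lambda>(n, s, t). p n s t) ` ({..k} \<times> {..<k} \<times> {..<k})))"
    by (intro finite_imp_bounded) auto
  then obtain L where L: "\<And>x. x \<in> insert A ((\<lambda>(n, s, t). p n s t) ` ({..k} \<times> {..<k} \<times> {..<k})) \<Longrightarrow> norm x \<le> L"
    unfolding bounded_iff by blast
  have LA: "\<bar>A\<bar> \<le> L" using L[of A] by simp
  have Lp: "\<bar>p n s t\<bar> \<le> L" if "n \<le> k" "s < k" "t < k" for n s t
    using L[of "p n s t"] that by force
  have int: "((\<lambda>c. \<Sum>s<k. \<Sum>t<n. max 0 (c - p n s t)) has_integral (\<Sum>s<k. \<Sum>t<n. (L - p n s t)\<^sup>2 / 2)) {-L..L}"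
    if "n \<le> k" for n
    using that by (intro has_integral_sum has_integral_pos_part Lp) auto
  have pw: "(\<Sum>s<k. \<Sum>t<k. max 0 (c - p k s t)) = (\<Sum>s<k. \<Sum>t<k-1. max 0 (c - p (k-1) s t)) + k * max 0 (c - A)" for c
  proof -
    have "(\<Sum>s<k. \<Sum>t<k. max 0 (c - p k s t)) - (\<Sum>s<k. \<Sum>t<k-1. max 0 (c - p (k-1) s t))
        = max 0 (\<Sum>i<k. c - z i)"
      unfolding p_def sum_pos_part_eta_mono sum_subtractf[symmetric] sh_def
      using sum_cyclic_max_prefix_increment[OF k, of "\<lambda>i. c - z i"] .
    also have "(\<Sum>i<k. c - z i) = k * (c - A)"
      using k by (simp add: sum_subtractf A_def S_def field_simps)
    also have "max 0 \<dots> = k * max 0 (c - A)"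
      by (simp add: max_mult_distrib_left)
    finally show ?thesis by simp
  qed
  have "((\<lambda>c. \<Sum>s<k. \<Sum>t<k. max 0 (c - p k s t)) has_integral
      (\<Sum>s<k. \<Sum>t<k-1. (L - p (k-1) s t)\<^sup>2 / 2) + k * ((L - A)\<^sup>2 / 2)) {-L..L}"
    unfolding pw
    by (intro has_integral_add int has_integral_mult_right has_integral_pos_part LA) auto
  from has_integral_unique[OF int[of k] this]
  have "(\<Sum>s<k. \<Sum>t<k. (L - p k s t)\<^sup>2) = (\<Sum>s<k. \<Sum>t<k-1. (L - p (k-1) s t)\<^sup>2) + k * (L - A)\<^sup>2"
    by (simp flip: sum_divide_distrib)
  \<comment> \<open>The linear term is explicit because projection preserves the sum, and because
    over all shifts each entry of \<open>z\<close> is counted \<open>n\<close> times.\<close>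
  moreover have ex: "(\<Sum>s<k. \<Sum>t<n. (L - p n s t)\<^sup>2)
      = k * n * L\<^sup>2 - 2 * L * (n * S) + (\<Sum>s<k. sqnorm n (p n s))" for n
  proof -
    have "(\<Sum>t<n. (L - p n s t)\<^sup>2) = n * L\<^sup>2 - 2 * L * (\<Sum>t<n. sh s t) + sqnorm n (p n s)" for s
    proof -
      have "(\<Sum>t<n. (L - p n s t)\<^sup>2) = (\<Sum>t<n. L\<^sup>2 - 2 * L * p n s t + (p n s t)\<^sup>2)"
        by (intro sum.cong refl) (simp add: power2_diff)
      then show ?thesis
        by (simp add: sum.distrib sum_subtractf sqnorm_def p_def sum_eta_mono flip: sum_distrib_left)
    qed
    then have "(\<Sum>s<k. \<Sum>t<n. (L - p n s t)\<^sup>2)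
        = k * n * L\<^sup>2 - 2 * L * (\<Sum>s<k. \<Sum>t<n. sh s t) + (\<Sum>s<k. sqnorm n (p n s))"
      by (simp add: sum.distrib sum_subtractf flip: sum_distrib_left)
    also have "(\<Sum>s<k. \<Sum>t<n. sh s t) = (\<Sum>t<n. \<Sum>s<k. z ((s + t) mod k))"
      unfolding sh_def by (rule sum.swap)
    also have "\<dots> = n * S" by (simp add: sum_mod_shift[OF k] S_def)
    finally show ?thesis .
  qed
  moreover have "k * (L - A)\<^sup>2 = k * L\<^sup>2 - 2 * L * S + S\<^sup>2 / k"
    using k by (simp add: A_def power2_eq_square field_simps)
  ultimately have "(\<Sum>s<k. sqnorm k (p k s)) = (\<Sum>s<k. sqnorm (k-1) (p (k-1) s)) + S\<^sup>2 / k"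
    using k unfolding ex by (simp add: of_nat_diff algebra_simps)
  then show ?thesis by (simp add: p_def sh_def S_def)
qed

section \<open>The Gaussian risk of a constant signal\<close>

lemma prob_space_std_normal: "prob_space (density lborel std_normal_density)"
  by (rule prob_space_normal_density) simp

lemma prob_space_gauss: "prob_space (gauss N)"
  unfolding gauss_def by (intro prob_space_PiM prob_space_std_normal)

lemma measurable_gauss_coordinate:
  "i < N \<Longrightarrow> (\<lambda>\<omega>. \<omega> i) \<in> borel_measurable (gauss N)"
  unfolding gauss_def
  using measurable_component_singleton[of i "{..<N}" "\<lambda>_. density lborel std_normal_density"]
  by (simp cong: measurable_cong_sets)

section \<open>Selecting coordinates of Gaussian noise\<close>

lemma distr_gauss_reindex:
  assumes "inj_on f {..<n}" "f \<in> {..<n} \<rightarrow> {..<N}"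
  shows "distr (gauss N) (gauss n) (\<lambda>\<omega>. \<lambda>i\<in>{..<n}. \<omega> (f i)) = gauss n"
  unfolding gauss_def using assms by (intro distr_PiM_reindex prob_space_std_normal)

lemma measurable_gauss_reindex:
  assumes "f \<in> {..<n} \<rightarrow> {..<N}"
  shows "(\<lambda>\<omega>. \<lambda>i\<in>{..<n}. \<omega> (f i)) \<in> gauss N \<rightarrow>\<^sub>M gauss n"
  using assms unfolding gauss_def
  by (intro measurable_restrict measurable_component_singleton) auto

lemma sqnorm_eta_mono_measurable:
  "(\<lambda>z. sqnorm n (eta_mono n z)) \<in> borel_measurable (gauss n)"
  unfolding sqnorm_def
  by (intro borel_measurable_sum borel_measurable_power eta_mono_measurable measurable_gauss_coordinate) auto

lemma sqnorm_eta_mono_reindex_measurable: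
  assumes "f \<in> {..<n} \<rightarrow> {..<N}"
  shows "(\<lambda>z. sqnorm n (eta_mono n (\<lambda>i. z (f i)))) \<in> borel_measurable (gauss N)"
  unfolding sqnorm_def using assms
  by (intro borel_measurable_sum borel_measurable_power eta_mono_measurable measurable_gauss_coordinate) auto

lemma nn_integral_sqnorm_eta_mono_reindex:
  assumes "inj_on f {..<n}" "f \<in> {..<n} \<rightarrow> {..<N}"
  shows "(\<integral>\<^sup>+z. ennreal (sqnorm n (eta_mono n (\<lambda>i. z (f i)))) \<partial>gauss N)
    = (\<integral>\<^sup>+z. ennreal (sqnorm n (eta_mono n z)) \<partial>gauss n)"
proof -
  have "(\<integral>\<^sup>+z. ennreal (sqnorm n (eta_mono n z)) \<partial>gauss n)
    = (\<integral>\<^sup>+z. ennreal (sqnorm n (eta_mono n z)) \<partial>distr (gauss N) (gauss n) (\<lambda>\<omega>. \<lambda>i\<in>{..<n}. \<omega> (f i)))"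
    by (simp add: distr_gauss_reindex[OF assms])
  also have "\<dots> = (\<integral>\<^sup>+z. ennreal (sqnorm n (eta_mono n (\<lambda>i\<in>{..<n}. z (f i)))) \<partial>gauss N)"
    using sqnorm_eta_mono_measurable by (intro nn_integral_distr measurable_gauss_reindex assms) auto
  also have "\<dots> = (\<integral>\<^sup>+z. ennreal (sqnorm n (eta_mono n (\<lambda>i. z (f i)))) \<partial>gauss N)"
    using eta_mono_cong[of n "\<lambda>i\<in>{..<n}. z (f i)" "\<lambda>i. z (f i)" for z] by simp
  finally show ?thesis ..
qed

text \<open>A sum of \<open>n\<close> independent standard normals is centred normal with variance
  \<open>n\<close>.\<close>

lemma nn_integral_gauss_sum_square:
  assumes n: "n \<ge> 1"
  shows "(\<integral>\<^sup>+z. ennreal ((\<Sum>i<n. z i)\<^sup>2) \<partial>gauss n) = ennreal (real n)"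
proof -
  interpret prob_space "gauss n" by (rule prob_space_gauss)
  have comp: "distr (gauss n) lborel (\<lambda>\<omega>. \<omega> i) = density lborel std_normal_density" if "i < n" for i
  proof -
    have "distr (gauss n) lborel (\<lambda>\<omega>. \<omega> i) = distr (gauss n) (density lborel std_normal_density) (\<lambda>\<omega>. \<omega> i)"
      by (intro distr_cong) auto
    also have "\<dots> = density lborel std_normal_density"
      unfolding gauss_def using that by (intro distr_PiM_component prob_space_std_normal) auto
    finally show ?thesis .
  qed
  have comp': "distr (gauss n) borel (\<lambda>\<omega>. \<omega> i) = density lborel std_normal_density" if "i < n" for i
  proof -
    have "distr (gauss n) borel (\<lambda>\<omega>. \<omega> i) = distr (gauss n) lborel (\<lambda>\<omega>. \<omega> i)"
      by (intro distr_cong) auto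
    then show ?thesis using comp[OF that] by simp
  qed
  have dist: "distributed (gauss n) lborel (\<lambda>\<omega>. \<omega> i) (normal_density 0 1)" if "i < n" for i
    unfolding distributed_def using comp[OF that] measurable_gauss_coordinate[OF that] by simp
  \<comment> \<open>Independence is read off from the joint law of the coordinates being the product
    of their marginals.\<close>
  have "indep_vars (\<lambda>_. borel) (\<lambda>i \<omega>. \<omega> i) {..<n}"
  proof (subst indep_vars_iff_distr_eq_PiM')
    show "{..<n} \<noteq> {}" using n by (auto simp: lessThan_empty_iff)
    show "random_variable borel (\<lambda>\<omega>. \<omega> i)" if "i \<in> {..<n}" for i
      using measurable_gauss_coordinate that by auto
    have s: "sets (\<Pi>\<^sub>M i\<in>{..<n}. borel) = sets (gauss n)"
      unfolding gauss_def by (intro sets_PiM_cong) auto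
    have "distr (gauss n) (\<Pi>\<^sub>M i\<in>{..<n}. borel) (\<lambda>x. \<lambda>i\<in>{..<n}. x i) = distr (gauss n) (gauss n) (\<lambda>x. x)"
      by (intro distr_cong s) (auto simp: gauss_def space_PiM restrict_PiE_iff PiE_def extensional_restrict)
    also have "\<dots> = gauss n" by simp
    also have "\<dots> = (\<Pi>\<^sub>M i\<in>{..<n}. distr (gauss n) borel (\<lambda>\<omega>. \<omega> i))"
      unfolding gauss_def[of n] by (intro PiM_cong refl comp'[symmetric, unfolded gauss_def]) simp
    finally show "distr (gauss n) (\<Pi>\<^sub>M i\<in>{..<n}. borel) (\<lambda>x. \<lambda>i\<in>{..<n}. x i)
      = (\<Pi>\<^sub>M i\<in>{..<n}. distr (gauss n) borel (\<lambda>\<omega>. \<omega> i))" .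
  qed
  then have "distributed (gauss n) lborel (\<lambda>\<omega>. \<Sum>i<n. \<omega> i)
      (normal_density (\<Sum>i<n. 0) (sqrt (\<Sum>i<n. 1\<^sup>2)))"
    using n by (intro sum_indep_normal dist) (auto simp: lessThan_empty_iff)
  then have D: "distributed (gauss n) lborel (\<lambda>\<omega>. \<Sum>i<n. \<omega> i) (normal_density 0 (sqrt n))"
    by simp
  have pos: "sqrt n > 0" using n by simp
  have "expectation (\<lambda>\<omega>. (\<Sum>i<n. \<omega> i)\<^sup>2) = n"
    using normal_distributed_variance[OF pos D] normal_distributed_expectation[OF pos D] by simp
  moreover have "integrable (gauss n) (\<lambda>\<omega>. (\<Sum>i<n. \<omega> i)\<^sup>2)"
    using integrable_normal_moment[OF pos, of 0 2]
      distributed_integrable[OF D, of "\<lambda>x. x\<^sup>2"] by simp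
  ultimately show ?thesis by (simp add: nn_integral_eq_integral)
qed

text \<open>Averaging the cyclic identity over the noise: each shift is again standard Gaussian, and
  the squared total divided by \<open>k\<close> has mean 1. Hence \<open>k\<close> times the risk at
  \<open>k\<close> is \<open>k\<close> times the risk at \<open>k - 1\<close> plus 1.\<close>

lemma nn_integral_sqnorm_eta_mono:
  "(\<integral>\<^sup>+z. ennreal (sqnorm n (eta_mono n z)) \<partial>gauss n) = ennreal (harm n)"
proof (induction n)
  case 0
  then show ?case by (simp add: sqnorm_def harm_def)
next
  case (Suc n)
  define k where "k = Suc n"
  define R where "R m = (\<integral>\<^sup>+z. ennreal (sqnorm m (eta_mono m z)) \<partial>gauss m)" for m
  have k: "k \<ge> 1" "k - 1 = n" by (auto simp: k_def)
  have sh: "(\<lambda>i. (s + i) mod k) \<in> {..<m} \<rightarrow> {..<k}" for s m using k by auto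
  \<comment> \<open>At most \<open>k\<close> consecutive integers have distinct residues, so a
    shifted window selects distinct noise coordinates.\<close>
  have inj: "inj_on (\<lambda>i. (s + i) mod k) {..<m}" if "m \<le> k" for s m
  proof (rule linorder_inj_onI')
    fix i j assume ij: "i \<in> {..<m}" "j \<in> {..<m}" "i < j"
    have "\<not> k dvd (s + j) - (s + i)"
      using ij that by (intro nat_dvd_not_less) auto
    then show "(s + i) mod k \<noteq> (s + j) mod k"
      using ij mod_eq_dvd_iff_nat[of "s + i" "s + j" k] by auto
  qed
  have sum: "(\<integral>\<^sup>+z. ennreal (\<Sum>s<k. sqnorm m (eta_mono m (\<lambda>i. z ((s + i) mod k)))) \<partial>gauss k) = of_nat k * R m"
    if "m \<le> k" for m
  proof -
    have "(\<integral>\<^sup>+z. ennreal (\<Sum>s<k. sqnorm m (eta_mono m (\<lambda>i. z ((s + i) mod k)))) \<partial>gauss k)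
      = (\<integral>\<^sup>+z. (\<Sum>s<k. ennreal (sqnorm m (eta_mono m (\<lambda>i. z ((s + i) mod k))))) \<partial>gauss k)"
      by (intro nn_integral_cong) (simp add: sum_ennreal sqnorm_nonneg)
    also have "\<dots> = (\<Sum>s<k. \<integral>\<^sup>+z. ennreal (sqnorm m (eta_mono m (\<lambda>i. z ((s + i) mod k)))) \<partial>gauss k)"
      by (intro nn_integral_sum measurable_compose[OF sqnorm_eta_mono_reindex_measurable] sh) simp
    also have "\<dots> = of_nat k * R m"
      unfolding R_def by (simp add: nn_integral_sqnorm_eta_mono_reindex[OF inj[OF that] sh])
    finally show ?thesis .
  qed
  have [measurable]: "(\<lambda>z. \<Sum>s<k. sqnorm n (eta_mono n (\<lambda>i. z ((s + i) mod k)))) \<in> borel_measurable (gauss k)"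
    by (intro borel_measurable_sum sqnorm_eta_mono_reindex_measurable sh)
  have [measurable]: "(\<lambda>z. (\<Sum>i<k. z i)\<^sup>2) \<in> borel_measurable (gauss k)"
    by (intro borel_measurable_sum borel_measurable_power measurable_gauss_coordinate) auto
  have "of_nat k * R k = (\<integral>\<^sup>+z. ennreal (\<Sum>s<k. sqnorm n (eta_mono n (\<lambda>i. z ((s + i) mod k))))
        + ennreal (1 / k) * ennreal ((\<Sum>i<k. z i)\<^sup>2) \<partial>gauss k)"
    unfolding sum[OF order_refl, symmetric] sum_cyclic_sqnorm_eta_mono[OF k(1)] k(2)
    by (intro nn_integral_cong) (simp add: ennreal_plus[symmetric] ennreal_mult[symmetric] sum_nonneg sqnorm_nonneg del: ennreal_plus)
  also have "\<dots> = of_nat k * R n + ennreal (1 / k) * ennreal k"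
    using k by (simp add: nn_integral_add nn_integral_cmult sum nn_integral_gauss_sum_square)
  also have "\<dots> = ennreal (k * harm n + 1)"
    using Suc.IH k
    by (simp add: R_def ennreal_of_nat_eq_real_of_nat harm_nonneg ennreal_plus flip: ennreal_mult)
  also have "k * harm n + 1 = k * harm k"
    by (simp add: k_def harm_Suc field_simps)
  also have "ennreal \<dots> = of_nat k * ennreal (harm k)"
    by (simp add: ennreal_of_nat_eq_real_of_nat harm_nonneg flip: ennreal_mult)
  finally show ?case
    using k by (simp add: R_def ennreal_mult_cancel_left k_def)
qed

lemma r_mono_eq_harm: "r_mono n = harm n"
  unfolding r_mono_def using sqnorm_nonneg
  by (subst integral_eq_nn_integral[OF sqnorm_eta_mono_measurable])
     (auto simp: nn_integral_sqnorm_eta_mono harm_nonneg)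

section \<open>Piecewise constant signals\<close>

text \<open>Block \<open>j < k\<close> consists of the indices from \<open>c j\<close> up to but excluding \<open>c (Suc j)\<close>.\<close>

definition blocks :: "nat \<Rightarrow> nat \<Rightarrow> (nat \<Rightarrow> nat) \<Rightarrow> bool" where
  "blocks k N c \<longleftrightarrow> c 0 = 0 \<and> c k = N \<and> (\<forall>j<k. c j < c (Suc j))"

lemma blocks_mono:
  assumes "blocks k N c" "i \<le> j" "j \<le> k"
  shows "c i \<le> c j"
  using assms(2,3)
proof (induction j rule: dec_induct)
  case (step j)
  then have "c j < c (Suc j)" using assms(1) by (simp add: blocks_def)
  with step show ?case by simp
qed simp

lemma blocks_le: "blocks k N c \<Longrightarrow> j \<le> k \<Longrightarrow> c j \<le> N"
  using blocks_mono[of k N c j k] by (simp add: blocks_def)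

lemma sum_blocks:
  assumes "blocks k N c"
  shows "(\<Sum>t<N. f t) = (\<Sum>j<k. \<Sum>i<c (Suc j) - c j. f (c j + i))"
proof -
  have "(\<Sum>t<c n. f t) = (\<Sum>j<n. \<Sum>i<c (Suc j) - c j. f (c j + i))" if "n \<le> k" for n
    using that
  proof (induction n)
    case 0
    then show ?case using assms by (simp add: blocks_def)
  next
    case (Suc n)
    have le: "c n \<le> c (Suc n)" using blocks_mono[OF assms, of n "Suc n"] Suc.prems by simp
    have "(\<Sum>t<c (Suc n). f t) = (\<Sum>t<c n. f t) + (\<Sum>t=c n..<c (Suc n). f t)"
      using sum.atLeastLessThan_concat[of 0 "c n" "c (Suc n)" f] le by (simp add: atLeast0LessThan)
    also have "(\<Sum>t=c n..<c (Suc n). f t) = (\<Sum>i<c (Suc n) - c n. f (c n + i))"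
      using sum.shift_bounds_nat_ivl[of f 0 "c n" "c (Suc n) - c n"] le
      by (simp add: atLeast0LessThan add.commute)
    finally show ?case using Suc by simp
  qed
  from this[of k] show ?thesis using assms by (simp add: blocks_def)
qed

lemma blocks_sum_length:
  assumes "blocks k N c"
  shows "(\<Sum>j<k. c (Suc j) - c j) = N"
  using sum_blocks[OF assms, of "\<lambda>_. 1::nat"] by simp

lemma block_exists:
  assumes "blocks k N c" "t < N"
  obtains j i where "j < k" "i < c (Suc j) - c j" "t = c j + i"
proof -
  define m where "m = (LEAST m. t < c m)"
  have tk: "t < c k" using assms by (simp add: blocks_def)
  have tm: "t < c m" unfolding m_def by (rule LeastI[of _ k]) (rule tk)
  have mk: "m \<le> k" unfolding m_def by (rule Least_le) (rule tk)
  have "m \<noteq> 0" using tm assms by (auto simp: blocks_def intro: ccontr)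
  then obtain j where j: "m = Suc j" by (cases m) auto
  then have "c j \<le> t" using not_less_Least[of j "\<lambda>m. t < c m"] by (simp add: m_def)
  then show ?thesis using that[of j "t - c j"] j tm mk by auto
qed

lemma nondecr_block:
  assumes "nondecr N u" "blocks k N c" "j < k"
  shows "nondecr (c (Suc j) - c j) (\<lambda>i. u (c j + i))"
  using assms blocks_le[OF assms(2), of "Suc j"] by (auto simp: nondecr_def)

text \<open>The squared error is at most the inner product of noise and error. Blockwise the noise
  may be replaced by its projection \<open>w\<close>; the bound
  \<open>w p \<le> (w\<^sup>2 + p\<^sup>2) / 2\<close> then lets half the squared error be absorbed
  on the left.\<close>

lemma sqnorm_eta_mono_error_le:
  assumes b: "blocks k N c" and x: "nondecr N x"
    and const: "\<And>j i. j < k \<Longrightarrow> i < c (Suc j) - c j \<Longrightarrow> x (c j + i) = a j"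
  shows "sqnorm N (\<lambda>t. x t - eta_mono N (\<lambda>s. x s + z s) t)
    \<le> (\<Sum>j<k. sqnorm (c (Suc j) - c j) (eta_mono (c (Suc j) - c j) (\<lambda>i. z (c j + i))))"
proof -
  define l where "l j = c (Suc j) - c j" for j
  define w where "w j = eta_mono (l j) (\<lambda>i. z (c j + i))" for j
  define p where "p t = eta_mono N (\<lambda>s. x s + z s) t - x t" for t
  \<comment> \<open>The true signal \<open>x\<close> serves as the test vector.\<close>
  have "(\<Sum>t<N. (p t)\<^sup>2 - z t * p t) \<le> 0"
    using eta_mono_variational[OF x, of "\<lambda>s. x s + z s"]
    by (simp add: p_def power2_eq_square algebra_simps)
  then have "sqnorm N p \<le> (\<Sum>t<N. z t * p t)" by (simp add: sqnorm_def sum_subtractf)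
  also have "\<dots> = (\<Sum>j<k. \<Sum>i<l j. z (c j + i) * p (c j + i))"
    unfolding l_def by (rule sum_blocks[OF b])
  also have "\<dots> \<le> (\<Sum>j<k. \<Sum>i<l j. ((w j i)\<^sup>2 + (p (c j + i))\<^sup>2) / 2)"
  proof (rule sum_mono)
    fix j assume j: "j \<in> {..<k}"
    have "nondecr (l j) (\<lambda>i. eta_mono N (\<lambda>s. x s + z s) (c j + i))"
      unfolding l_def using j by (intro nondecr_block[OF nondecr_eta_mono b]) simp
    \<comment> \<open>Subtracting \<open>x\<close>, constant on the block, keeps the error
      nondecreasing there, so polarity of the block projection applies.\<close>
    then have "nondecr (l j) (\<lambda>i. p (c j + i))"
      using const[of j] j unfolding nondecr_def p_def l_def by (simp add: add_Suc_right[symmetric] del: add_Suc_right)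
    from eta_mono_residual_polar[OF this, of "\<lambda>i. z (c j + i)"]
    have "(\<Sum>i<l j. z (c j + i) * p (c j + i)) \<le> (\<Sum>i<l j. w j i * p (c j + i))"
      by (simp add: w_def algebra_simps sum_subtractf)
    also have "\<dots> \<le> (\<Sum>i<l j. ((w j i)\<^sup>2 + (p (c j + i))\<^sup>2) / 2)"
      using sum_squares_bound[of "w j i" "p (c j + i)" for i]
      by (intro sum_mono) (simp add: field_simps)
    finally show "(\<Sum>i<l j. z (c j + i) * p (c j + i)) \<le> (\<Sum>i<l j. ((w j i)\<^sup>2 + (p (c j + i))\<^sup>2) / 2)" .
  qed
  also have "\<dots> = ((\<Sum>j<k. sqnorm (l j) (w j)) + sqnorm N p) / 2"
    unfolding sqnorm_def sum_blocks[OF b, of "\<lambda>t. (p t)\<^sup>2"] l_def[symmetric]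
    by (simp add: sum.distrib add_divide_distrib flip: sum_divide_distrib)
  finally have "sqnorm N p \<le> (\<Sum>j<k. sqnorm (l j) (w j))" by simp
  then show ?thesis by (simp add: p_def l_def w_def sqnorm_def power2_commute)
qed

section \<open>Signals with a prescribed block structure\<close>

definition block_index :: "(nat \<Rightarrow> nat) \<Rightarrow> nat \<Rightarrow> nat" where
  "block_index c t = (LEAST j. t < c (Suc j))"

lemma block_index_eq:
  assumes "blocks k N c" "j < k" "i < c (Suc j) - c j"
  shows "block_index c (c j + i) = j"
  unfolding block_index_def
proof (rule Least_equality)
  fix m assume "c j + i < c (Suc m)"
  then show "j \<le> m" using blocks_mono[OF assms(1), of "Suc m" j] assms(2) by fastforce
qed (use assms in simp)

lemma blocks_pos: "blocks k N c \<Longrightarrow> j < k \<Longrightarrow> 0 < c (Suc j) - c j"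
  by (simp add: blocks_def)

text \<open>Monotonicity and jump counts reduce to these two cases. The summand \<open>+ 0\<close>
  keeps the shape \<open>c j + i\<close> in which block entries are addressed.\<close>

lemma block_successor:
  assumes b: "blocks k N c" and "Suc t < N" "j < k" "i < c (Suc j) - c j" "t = c j + i"
  obtains "Suc i < c (Suc j) - c j" "Suc t = c j + Suc i" | "Suc j < k" "Suc t = c (Suc j) + 0"
proof (cases "Suc i < c (Suc j) - c j")
  case False
  then have *: "Suc t = c (Suc j)" using assms by auto
  then have "Suc j \<noteq> k" using assms by (auto simp: blocks_def)
  then show ?thesis using * that(2) assms by simp
qed (use assms that in auto)

lemma nondecr_block_index:
  assumes b: "blocks k N c" and M: "M \<ge> 0"
  shows "nondecr N (\<lambda>t. M * real (block_index c t))"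
  unfolding nondecr_def
proof (intro allI impI)
  fix t assume t: "Suc t < N"
  obtain j i where ji: "j < k" "i < c (Suc j) - c j" "t = c j + i"
    using block_exists[OF b Suc_lessD[OF t]] .
  from block_successor[OF b t ji]
  have "block_index c t \<le> block_index c (Suc t)"
  proof cases
    case 1
    then show ?thesis
      using ji block_index_eq[OF b ji(1,2)] block_index_eq[OF b ji(1) 1(1)] by simp
  next
    case 2
    then show ?thesis
      using ji block_index_eq[OF b ji(1,2)] block_index_eq[OF b 2(1) blocks_pos[OF b 2(1)]] by simp
  qed
  then show "M * real (block_index c t) \<le> M * real (block_index c (Suc t))"
    using M by (intro mult_left_mono) auto
qed

text \<open>A jump can only occur at the last index of a block other than the final one. For
  \<open>M = 0\<close> there is none, hence an inequality.\<close>

lemma njumps_block_index: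
  assumes b: "blocks k N c"
  shows "njumps N (restrict (\<lambda>t. M * real (block_index c t)) {..<N}) \<le> k - 1"
proof -
  let ?J = "{t. Suc t < N \<and> restrict (\<lambda>t. M * real (block_index c t)) {..<N} t
      < restrict (\<lambda>t. M * real (block_index c t)) {..<N} (Suc t)}"
  have "?J \<subseteq> (\<lambda>j. c (Suc j) - 1) ` {..<k - 1}"
  proof
    fix t assume "t \<in> ?J"
    then have t: "Suc t < N" and lt: "M * real (block_index c t) < M * real (block_index c (Suc t))" by auto
    obtain j i where ji: "j < k" "i < c (Suc j) - c j" "t = c j + i"
      using block_exists[OF b Suc_lessD[OF t]] .
    from block_successor[OF b t ji]
    show "t \<in> (\<lambda>j. c (Suc j) - 1) ` {..<k - 1}"
    proof cases
      case 1
      then show ?thesis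
        using lt ji block_index_eq[OF b ji(1,2)] block_index_eq[OF b ji(1) 1(1)] by simp
    next
      case 2
      then show ?thesis by (intro image_eqI[of _ _ j]) auto
    qed
  qed
  then have "card ?J \<le> card ((\<lambda>j. c (Suc j) - 1) ` {..<k - 1})" by (intro card_mono) auto
  also have "\<dots> \<le> k - 1" using card_image_le[of "{..<k - 1}"] by fastforce
  finally show ?thesis by (simp add: njumps_def)
qed

text \<open>If the steps of the signal dominate the oscillation of the block projections, the signal
  plus the concatenated block projections is still nondecreasing. The variational inequality splits
  over blocks, so this vector is the projection.\<close>

lemma sqnorm_eta_mono_error_eq_large_jumps:
  assumes b: "blocks k N c"
    and B: "\<And>j i. j < k \<Longrightarrow> i < c (Suc j) - c j \<Longrightarrow>
      \<bar>eta_mono (c (Suc j) - c j) (\<lambda>i. z (c j + i)) i\<bar> \<le> B"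
    and M: "M \<ge> 2 * B" "M \<ge> 0"
  defines "x \<equiv> \<lambda>t. M * real (block_index c t)"
  shows "sqnorm N (\<lambda>t. x t - eta_mono N (\<lambda>s. x s + z s) t)
    = (\<Sum>j<k. sqnorm (c (Suc j) - c j) (eta_mono (c (Suc j) - c j) (\<lambda>i. z (c j + i))))"
proof -
  define l where "l j = c (Suc j) - c j" for j
  define w where "w j = eta_mono (l j) (\<lambda>i. z (c j + i))" for j
  define g where "g t = w (block_index c t) (t - c (block_index c t))" for t
  have x: "x (c j + i) = M * j" and g: "g (c j + i) = w j i" if "j < k" "i < l j" for i j
    using block_index_eq[OF b, of j i] that by (simp_all add: x_def g_def l_def)
  have nx: "nondecr N x" unfolding x_def by (rule nondecr_block_index[OF b M(2)])
  have "nondecr N (\<lambda>t. x t + g t)"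
    unfolding nondecr_def
  proof (intro allI impI)
    fix t assume t: "Suc t < N"
    obtain j i where ji: "j < k" "i < c (Suc j) - c j" "t = c j + i"
      using block_exists[OF b Suc_lessD[OF t]] .
    from block_successor[OF b t ji]
    show "x t + g t \<le> x (Suc t) + g (Suc t)"
    proof cases
      case 1
      then have "w j i \<le> w j (Suc i)"
        using nondecr_eta_mono[of "l j"] unfolding w_def nondecr_def l_def by simp
      then show ?thesis
        using 1 ji x[of j i] g[of j i] x[of j "Suc i"] g[of j "Suc i"] by (simp add: l_def)
    next
      case 2
      have pos: "0 < l (Suc j)" using blocks_pos[OF b 2(1)] by (simp add: l_def)
      \<comment> \<open>Both values are at most \<open>B\<close> in modulus, which is where
        \<open>M \<ge> 2 * B\<close> enters.\<close>
      have "w j i - w (Suc j) 0 \<le> M"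
        using B[OF ji(1,2)] B[OF 2(1), of 0] pos M by (simp add: w_def l_def)
      then show ?thesis
        using 2 ji x[of j i] g[of j i] x[OF 2(1) pos] g[OF 2(1) pos] by (simp add: l_def algebra_simps)
    qed
  qed
  then have "eta_mono N (\<lambda>s. x s + z s) = restrict (\<lambda>t. x t + g t) {..<N}"
  proof (rule eta_mono_eqI)
    fix v assume v: "nondecr N v"
    have "(\<Sum>t<N. (x t + z t - (x t + g t)) * (v t - (x t + g t)))
      = (\<Sum>j<k. \<Sum>i<l j. (z (c j + i) - g (c j + i)) * (v (c j + i) - (x (c j + i) + g (c j + i))))"
      unfolding l_def by (subst sum_blocks[OF b]) simp
    also have "\<dots> = (\<Sum>j<k. \<Sum>i<l j. (z (c j + i) - w j i) * (v (c j + i) - M * j - w j i))"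
      by (intro sum.cong refl) (simp add: x g)
    also have "\<dots> \<le> (\<Sum>j<k. 0)"
    proof (rule sum_mono)
      fix j assume "j \<in> {..<k}"
      then have "nondecr (l j) (\<lambda>i. v (c j + i))"
        unfolding l_def by (intro nondecr_block[OF v b]) simp
      then have "nondecr (l j) (\<lambda>i. v (c j + i) - M * j)" by (simp add: nondecr_def)
      from eta_mono_variational[OF this]
      show "(\<Sum>i<l j. (z (c j + i) - w j i) * (v (c j + i) - M * j - w j i)) \<le> 0"
        by (simp add: w_def)
    qed
    finally show "(\<Sum>t<N. (x t + z t - (x t + g t)) * (v t - (x t + g t))) \<le> 0" by simp
  qed
  then have "sqnorm N (\<lambda>t. x t - eta_mono N (\<lambda>s. x s + z s) t) = (\<Sum>t<N. (g t)\<^sup>2)"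
    by (simp add: sqnorm_def)
  also have "\<dots> = (\<Sum>j<k. \<Sum>i<l j. (g (c j + i))\<^sup>2)"
    unfolding l_def by (rule sum_blocks[OF b])
  also have "\<dots> = (\<Sum>j<k. sqnorm (l j) (w j))"
    unfolding sqnorm_def by (intro sum.cong refl) (simp add: g)
  finally show ?thesis by (simp add: l_def w_def)
qed

section \<open>Decomposition of a nondecreasing signal into constant pieces\<close>

lemma njumps_Suc: "njumps (Suc n) x = (\<Sum>t<n. if x t < x (Suc t) then 1 else 0)"
proof -
  have "{t. Suc t < Suc n \<and> x t < x (Suc t)} = {t \<in> {..<n}. x t < x (Suc t)}" by auto
  then show ?thesis by (simp add: njumps_def sum.If_cases Int_def)
qed

text \<open>Induction on the length: the new last entry opens a block if there is a jump, and
  otherwise extends the last block, since monotonicity then forces equality.\<close>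

lemma constant_blocks_exist:
  assumes "nondecr (Suc n) x"
  shows "\<exists>c a. blocks (Suc (njumps (Suc n) x)) (Suc n) c \<and>
    (\<forall>j < Suc (njumps (Suc n) x). \<forall>i < c (Suc j) - c j. x (c j + i) = a j)"
  using assms
proof (induction n)
  case 0
  then show ?case
    by (intro exI[of _ "\<lambda>j. j"] exI[of _ "\<lambda>_. x 0"]) (auto simp: njumps_Suc blocks_def)
next
  case (Suc n)
  define k where "k = njumps (Suc n) x"
  have "nondecr (Suc n) x" using Suc.prems by (simp add: nondecr_def)
  from Suc.IH[OF this] obtain c a where b: "blocks (Suc k) (Suc n) c"
    and const: "\<And>j i. j < Suc k \<Longrightarrow> i < c (Suc j) - c j \<Longrightarrow> x (c j + i) = a j"
    unfolding k_def by blast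
  have ck: "c (Suc k) = Suc n" "c k < Suc n" using b by (auto simp: blocks_def)
  show ?case
  proof (cases "x n < x (Suc n)")
    case True
    then have nj: "njumps (Suc (Suc n)) x = Suc k" by (simp add: njumps_Suc k_def)
    let ?c = "c(Suc (Suc k) := Suc (Suc n))" and ?a = "a(Suc k := x (Suc n))"
    have "blocks (Suc (Suc k)) (Suc (Suc n)) ?c"
      using b by (auto simp: blocks_def less_Suc_eq)
    moreover have "x (?c j + i) = ?a j" if "j < Suc (Suc k)" "i < ?c (Suc j) - ?c j" for i j
      using that const[of j i] ck by (cases "j = Suc k") auto
    ultimately show ?thesis unfolding nj by blast
  next
    case False
    then have eq: "x (Suc n) = x n" using Suc.prems by (auto simp: nondecr_def)
    have nj: "njumps (Suc (Suc n)) x = k" using False by (simp add: njumps_Suc k_def)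
    let ?c = "c(Suc k := Suc (Suc n))"
    have "blocks (Suc k) (Suc (Suc n)) ?c"
      using b by (auto simp: blocks_def less_Suc_eq)
    moreover have "x (?c j + i) = a j" if j: "j < Suc k" "i < ?c (Suc j) - ?c j" for i j
    \<comment> \<open>This pair addresses the appended index \<open>Suc n\<close>, the only one not
      covered by the induction hypothesis.\<close>
    proof (cases "j = k \<and> i = Suc n - c k")
      case True
      then have "?c j + i = Suc n" using ck by simp
      moreover have "x n = a k" using const[of k "n - c k"] ck by simp
      ultimately show ?thesis using eq True by simp
    next
      case False
      then show ?thesis using j const[of j i] ck by (cases "j = k") auto
    qed
    ultimately show ?thesis unfolding nj by blast
  qed
qed

section \<open>Risk bounds\<close>

lemma measurable_coordinate_of_sets_vec_space:
  assumes "sets \<nu> = sets (vec_space N)" "s < N"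
  shows "(\<lambda>x. x s) \<in> borel_measurable \<nu>"
  using measurable_component_singleton[of s "{..<N}" "\<lambda>_. lborel"] assms
  by (simp add: vec_space_def cong: measurable_cong_sets)

lemma space_eq_of_sets_vec_space:
  assumes "sets \<nu> = sets (vec_space N)"
  shows "space \<nu> = extensional {..<N}"
  using sets_eq_imp_space_eq[OF assms] by (auto simp: vec_space_def space_PiM PiE_def)

lemma njumps_measurable:
  assumes "sets \<nu> = sets (vec_space N)"
  shows "(\<lambda>x. real (njumps N x)) \<in> borel_measurable \<nu>"
proof (cases N)
  case 0
  then show ?thesis by (simp add: njumps_def)
next
  case (Suc n)
  have "(\<lambda>x. if x t < x (Suc t) then 1 else 0 :: real) \<in> borel_measurable \<nu>" if "t < n" for t
  proof -
    have [measurable]: "(\<lambda>x. x t) \<in> borel_measurable \<nu>" "(\<lambda>x. x (Suc t)) \<in> borel_measurable \<nu>"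
      using measurable_coordinate_of_sets_vec_space[OF assms] that Suc by simp_all
    show ?thesis by measurable
  qed
  then have "(\<lambda>x. \<Sum>t<n. if x t < x (Suc t) then 1 else 0 :: real) \<in> borel_measurable \<nu>"
    by (intro borel_measurable_sum) auto
  then show ?thesis by (simp add: Suc njumps_Suc if_distrib[of real] cong: if_cong)
qed

lemma mono_cone_pred_measurable: "Measurable.pred (vec_space N) (\<lambda>x. x \<in> mono_cone N)"
proof -
  have "Measurable.pred (vec_space N) (\<lambda>x. \<forall>t\<in>{t. Suc t < N}. x t \<le> x (Suc t))"
  proof (rule pred_intros_finite)
    show "finite {t. Suc t < N}" by (rule finite_subset[of _ "{..<N}"]) auto
    show "Measurable.pred (vec_space N) (\<lambda>x. x t \<le> x (Suc t))" if "t \<in> {t. Suc t < N}" for t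
      using that unfolding pred_def by (intro borel_measurable_le measurable_coordinate_of_sets_vec_space[OF refl]) auto
  qed
  then show ?thesis
    by (rule measurable_cong[THEN iffD1, rotated])
       (auto simp: mono_cone_iff nondecr_def space_eq_of_sets_vec_space[OF refl])
qed

lemma risk_integrand_measurable:
  assumes "sets \<nu> = sets (vec_space N)"
  shows "(\<lambda>xz. sqnorm N (\<lambda>t. fst xz t - eta_mono N (\<lambda>s. fst xz s + snd xz s) t))
    \<in> borel_measurable (\<nu> \<Otimes>\<^sub>M gauss N)"
proof -
  have 1: "(\<lambda>xz. fst xz s) \<in> borel_measurable (\<nu> \<Otimes>\<^sub>M gauss N)" if "s < N" for s
    by (rule measurable_compose[OF measurable_fst measurable_coordinate_of_sets_vec_space[OF assms that]])
  have 2: "(\<lambda>xz. snd xz s) \<in> borel_measurable (\<nu> \<Otimes>\<^sub>M gauss N)" if "s < N" for s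
    by (rule measurable_compose[OF measurable_snd measurable_gauss_coordinate[OF that]])
  show ?thesis
    unfolding sqnorm_def using 1 2
    by (intro borel_measurable_sum borel_measurable_power borel_measurable_diff eta_mono_measurable
        borel_measurable_add) auto
qed

lemma risk_mono_iterated:
  assumes "sets \<nu> = sets (vec_space N)"
  shows "risk_mono N \<nu> = (\<integral>\<^sup>+x. \<integral>\<^sup>+z. ennreal (sqnorm N (\<lambda>t. x t - eta_mono N (\<lambda>s. x s + z s) t))
      \<partial>gauss N \<partial>\<nu>)"
proof -
  interpret prob_space "gauss N" by (rule prob_space_gauss)
  show ?thesis
    unfolding risk_mono_def
    using nn_integral_fst[OF measurable_compose[OF risk_integrand_measurable[OF assms] measurable_ennreal]]
    by simp
qed

text \<open>The noise on a block is a standard Gaussian vector of the block's length, so linearity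
  gives the sum of the constant-signal risks.\<close>

lemma nn_integral_block_sum:
  assumes b: "blocks k N c"
  shows "(\<integral>\<^sup>+z. ennreal (\<Sum>j<k. sqnorm (c (Suc j) - c j)
      (eta_mono (c (Suc j) - c j) (\<lambda>i. z (c j + i)))) \<partial>gauss N)
    = ennreal (\<Sum>j<k. harm (c (Suc j) - c j))"
proof -
  have f: "(\<lambda>i. c j + i) \<in> {..<c (Suc j) - c j} \<rightarrow> {..<N}" if "j < k" for j
    using blocks_le[OF b, of "Suc j"] that by auto
  have "(\<integral>\<^sup>+z. ennreal (\<Sum>j<k. sqnorm (c (Suc j) - c j)
      (eta_mono (c (Suc j) - c j) (\<lambda>i. z (c j + i)))) \<partial>gauss N)
    = (\<integral>\<^sup>+z. (\<Sum>j<k. ennreal (sqnorm (c (Suc j) - c j)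
      (eta_mono (c (Suc j) - c j) (\<lambda>i. z (c j + i))))) \<partial>gauss N)"
    by (simp add: sum_ennreal sqnorm_nonneg)
  also have "\<dots> = (\<Sum>j<k. \<integral>\<^sup>+z. ennreal (sqnorm (c (Suc j) - c j)
      (eta_mono (c (Suc j) - c j) (\<lambda>i. z (c j + i)))) \<partial>gauss N)"
    using f by (intro nn_integral_sum measurable_compose[OF sqnorm_eta_mono_reindex_measurable measurable_ennreal]) auto
  also have "\<dots> = (\<Sum>j<k. ennreal (harm (c (Suc j) - c j)))"
    using f by (intro sum.cong refl)
      (simp add: nn_integral_sqnorm_eta_mono_reindex[of "\<lambda>i. c _ + i"] nn_integral_sqnorm_eta_mono)
  finally show ?thesis by (simp add: sum_ennreal harm_nonneg)
qed

text \<open>Block lengths add up to \<open>N\<close>, so an affine majorant of \<open>harm\<close>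
  bounds the risk by a function affine in the number of blocks; its expectation is controlled by the
  jump budget. The \<open>+ 1\<close> arises because there is one block more than jumps.\<close>

lemma risk_mono_le:
  fixes \<epsilon> \<alpha> \<beta> :: real
  assumes \<nu>: "\<nu> \<in> F_mono N \<epsilon>" and N: "N \<ge> 1" and \<epsilon>: "\<epsilon> \<ge> 0"
    and line: "\<And>l. harm l \<le> \<alpha> + \<beta> * real l" and nonneg: "\<alpha> \<ge> 0" "\<beta> \<ge> 0"
  shows "risk_mono N \<nu> \<le> ennreal (\<alpha> * (N * \<epsilon> + 1) + \<beta> * N)"
proof -
  obtain n where n: "N = Suc n" using N by (cases N) auto
  from \<nu> have ps: "prob_space \<nu>" and s: "sets \<nu> = sets (vec_space N)"
    and ae: "AE x in \<nu>. x \<in> mono_cone N"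
    and jumps: "(\<integral>\<^sup>+ x. ennreal (real (njumps N x)) \<partial>\<nu>) \<le> ennreal (real N * \<epsilon>)"
    by (auto simp: F_mono_def)
  interpret prob_space \<nu> by (rule ps)
  have inner: "(\<integral>\<^sup>+z. ennreal (sqnorm N (\<lambda>t. x t - eta_mono N (\<lambda>s. x s + z s) t)) \<partial>gauss N)
      \<le> ennreal \<alpha> * ennreal (real (njumps N x)) + ennreal (\<alpha> + \<beta> * N)" if "x \<in> mono_cone N" for x
  proof -
    define k where "k = Suc (njumps N x)"
    have nx: "nondecr N x" using that by (simp add: mono_cone_iff)
    obtain c a where b: "blocks k N c"
      and const: "\<And>j i. j < k \<Longrightarrow> i < c (Suc j) - c j \<Longrightarrow> x (c j + i) = a j"
      using constant_blocks_exist[of n x] nx unfolding n k_def by blast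
    have "(\<integral>\<^sup>+z. ennreal (sqnorm N (\<lambda>t. x t - eta_mono N (\<lambda>s. x s + z s) t)) \<partial>gauss N)
      \<le> (\<integral>\<^sup>+z. ennreal (\<Sum>j<k. sqnorm (c (Suc j) - c j)
          (eta_mono (c (Suc j) - c j) (\<lambda>i. z (c j + i)))) \<partial>gauss N)"
      by (intro nn_integral_mono ennreal_leI sqnorm_eta_mono_error_le[OF b nx const])
    also have "\<dots> = ennreal (\<Sum>j<k. harm (c (Suc j) - c j))" by (rule nn_integral_block_sum[OF b])
    also have "\<dots> \<le> ennreal (\<Sum>j<k. \<alpha> + \<beta> * real (c (Suc j) - c j))"
      by (intro ennreal_leI sum_mono line)
    also have "(\<Sum>j<k. \<alpha> + \<beta> * real (c (Suc j) - c j)) = \<alpha> * k + \<beta> * N"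
      using blocks_sum_length[OF b] by (simp add: sum.distrib flip: sum_distrib_left of_nat_sum)
    also have "\<dots> = \<alpha> * real (njumps N x) + (\<alpha> + \<beta> * N)" by (simp add: k_def algebra_simps)
    also have "ennreal \<dots> = ennreal \<alpha> * ennreal (real (njumps N x)) + ennreal (\<alpha> + \<beta> * N)"
      using nonneg by (simp add: ennreal_mult)
    finally show ?thesis .
  qed
  have m: "(\<lambda>x. ennreal (real (njumps N x))) \<in> borel_measurable \<nu>"
    using njumps_measurable[OF s] by simp
  have "risk_mono N \<nu> \<le> (\<integral>\<^sup>+x. ennreal \<alpha> * ennreal (real (njumps N x)) + ennreal (\<alpha> + \<beta> * N) \<partial>\<nu>)"
    unfolding risk_mono_iterated[OF s] using ae by (intro nn_integral_mono_AE) (auto intro: inner)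
  also have "\<dots> = ennreal \<alpha> * (\<integral>\<^sup>+x. ennreal (real (njumps N x)) \<partial>\<nu>) + ennreal (\<alpha> + \<beta> * N)"
    using m by (simp add: nn_integral_add nn_integral_cmult emeasure_space_1)
  also have "\<dots> \<le> ennreal \<alpha> * ennreal (real N * \<epsilon>) + ennreal (\<alpha> + \<beta> * N)"
    by (intro add_mono mult_left_mono jumps) auto
  also have "\<dots> = ennreal (\<alpha> * (N * \<epsilon> + 1) + \<beta> * N)"
    using nonneg \<epsilon> by (simp add: algebra_simps flip: ennreal_mult ennreal_plus)
  finally show ?thesis .
qed

section \<open>Lower bound from point masses\<close>

lemma return_in_F_mono:
  fixes \<epsilon> :: real
  assumes x: "x \<in> mono_cone N" and jumps: "real (njumps N x) \<le> N * \<epsilon>"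
  shows "return (vec_space N) x \<in> F_mono N \<epsilon>"
proof -
  have sp: "x \<in> space (vec_space N)"
    using x by (simp add: space_eq_of_sets_vec_space[OF refl] mono_cone_iff)
  have "(\<integral>\<^sup>+ x. ennreal (real (njumps N x)) \<partial>return (vec_space N) x) = ennreal (real (njumps N x))"
    using njumps_measurable[of "vec_space N"] by (intro nn_integral_return sp) auto
  moreover have "AE y in return (vec_space N) x. y \<in> mono_cone N"
    using x by (subst AE_return[OF sp mono_cone_pred_measurable])
  ultimately show ?thesis
    using jumps by (auto simp: F_mono_def prob_space_return[OF sp] ennreal_leI)
qed

lemma risk_mono_return:
  assumes x: "x \<in> mono_cone N"
  shows "risk_mono N (return (vec_space N) x)
    = (\<integral>\<^sup>+z. ennreal (sqnorm N (\<lambda>t. x t - eta_mono N (\<lambda>s. x s + z s) t)) \<partial>gauss N)"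
proof -
  interpret prob_space "gauss N" by (rule prob_space_gauss)
  have sp: "x \<in> space (vec_space N)"
    using x by (simp add: space_eq_of_sets_vec_space[OF refl] mono_cone_iff)
  have "(\<lambda>x. \<integral>\<^sup>+z. ennreal (sqnorm N (\<lambda>t. x t - eta_mono N (\<lambda>s. x s + z s) t)) \<partial>gauss N)
      \<in> borel_measurable (vec_space N)"
    using borel_measurable_nn_integral_fst[OF measurable_compose[OF risk_integrand_measurable[OF refl] measurable_ennreal]]
    by simp
  then show ?thesis
    by (subst risk_mono_iterated) (auto intro!: nn_integral_return sp)
qed

text \<open>Take point masses at the step signals with jump height \<open>M\<close>. For each fixed
  noise vector the error equals the blockwise sum once \<open>M\<close> is large, and Fatou's lemma
  carries this to the expectations.\<close>

lemma SUP_risk_mono_ge: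
  fixes \<epsilon> :: real
  assumes b: "blocks k N c" and k: "real (k - 1) \<le> N * \<epsilon>"
  shows "ennreal (\<Sum>j<k. harm (c (Suc j) - c j)) \<le> (SUP \<nu>\<in>F_mono N \<epsilon>. risk_mono N \<nu>)"
proof -
  define x where "x M = (\<lambda>t. real M * real (block_index c t))" for M :: nat
  define y where "y M = restrict (x M) {..<N}" for M :: nat
  define f where "f M z = ennreal (sqnorm N (\<lambda>t. x M t - eta_mono N (\<lambda>s. x M s + z s) t))" for M z
  define g where "g z = ennreal (\<Sum>j<k. sqnorm (c (Suc j) - c j)
      (eta_mono (c (Suc j) - c j) (\<lambda>i. z (c j + i))))" for z
  have f_meas: "f M \<in> borel_measurable (gauss N)" for M
    unfolding f_def sqnorm_def
    by (intro measurable_compose[OF _ measurable_ennreal] borel_measurable_sum borel_measurable_power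
        borel_measurable_diff eta_mono_measurable borel_measurable_add measurable_gauss_coordinate) auto
  have lim: "liminf (\<lambda>M. f M z) = g z" for z
  proof -
    have "finite (\<Union>j<k. (\<lambda>i. eta_mono (c (Suc j) - c j) (\<lambda>i. z (c j + i)) i) ` {..<c (Suc j) - c j})"
      by auto
    from finite_imp_bounded[OF this] obtain B where B: "\<And>w. w \<in> (\<Union>j<k. (\<lambda>i. eta_mono (c (Suc j) - c j) (\<lambda>i. z (c j + i)) i) ` {..<c (Suc j) - c j})
        \<Longrightarrow> norm w \<le> B"
      unfolding bounded_iff by blast
    \<comment> \<open>The threshold depends on \<open>z\<close>, so convergence is only pointwise
      here.\<close>
    obtain M0 :: nat where M0: "2 * B \<le> M0" using real_arch_simple by blast
    have "f M z = g z" if "M \<ge> M0" for M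
      unfolding f_def g_def x_def
      by (intro arg_cong[of _ _ ennreal] sqnorm_eta_mono_error_eq_large_jumps[OF b, of z B])
         (use B M0 that in force)+
    then have "(\<lambda>M. f M z) \<longlonglongrightarrow> g z"
      by (intro tendsto_eventually) (auto simp: eventually_sequentially)
    then show ?thesis by (intro lim_imp_Liminf) auto
  qed
  have le: "(\<integral>\<^sup>+z. f M z \<partial>gauss N) \<le> (SUP \<nu>\<in>F_mono N \<epsilon>. risk_mono N \<nu>)" for M
  proof -
    have cone: "y M \<in> mono_cone N"
      unfolding y_def x_def by (intro restrict_in_mono_cone nondecr_block_index[OF b]) simp
    have "real (njumps N (y M)) \<le> N * \<epsilon>"
      using njumps_block_index[OF b, of "real M"] k unfolding y_def x_def by linarith
    note F = return_in_F_mono[OF cone this]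
    have "(\<integral>\<^sup>+z. f M z \<partial>gauss N) = risk_mono N (return (vec_space N) (y M))"
      unfolding risk_mono_return[OF cone] f_def
    proof (intro nn_integral_cong arg_cong[of _ _ ennreal])
      fix z :: "nat \<Rightarrow> real"
      have "eta_mono N (\<lambda>s. y M s + z s) = eta_mono N (\<lambda>s. x M s + z s)"
        by (rule eta_mono_cong) (simp add: y_def)
      then show "sqnorm N (\<lambda>t. x M t - eta_mono N (\<lambda>s. x M s + z s) t)
        = sqnorm N (\<lambda>t. y M t - eta_mono N (\<lambda>s. y M s + z s) t)"
        by (simp add: sqnorm_def y_def)
    qed
    also have "\<dots> \<le> (SUP \<nu>\<in>F_mono N \<epsilon>. risk_mono N \<nu>)" by (rule SUP_upper[OF F])
    finally show ?thesis .
  qed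
  have "ennreal (\<Sum>j<k. harm (c (Suc j) - c j)) = (\<integral>\<^sup>+z. g z \<partial>gauss N)"
    unfolding g_def by (rule nn_integral_block_sum[OF b, symmetric])
  also have "\<dots> = (\<integral>\<^sup>+z. liminf (\<lambda>M. f M z) \<partial>gauss N)" by (simp add: lim)
  also have "\<dots> \<le> liminf (\<lambda>M. \<integral>\<^sup>+z. f M z \<partial>gauss N)"
    by (intro nn_integral_liminf f_meas)
  also have "\<dots> \<le> limsup (\<lambda>M. \<integral>\<^sup>+z. f M z \<partial>gauss N)" by (rule Liminf_le_Limsup) simp
  also have "\<dots> \<le> (SUP \<nu>\<in>F_mono N \<epsilon>. risk_mono N \<nu>)"
    by (rule Limsup_bounded) (simp add: le)
  finally show ?thesis .
qed

section \<open>The limit\<close>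

text \<open>The increments of \<open>harm\<close> decrease: from \<open>m\<close> on they are at
  most the slope \<open>1 / (m + 1)\<close>, before \<open>m\<close> at least that slope.\<close>

lemma harm_le_chord: "harm l \<le> harm m - real m / (real m + 1) + 1 / (real m + 1) * real l"
proof (cases "m \<le> l")
  case True
  then show ?thesis
  proof (induction l rule: dec_induct)
    case (step n)
    have "inverse (real (Suc n)) \<le> 1 / (real m + 1)"
      using step by (simp add: field_simps)
    with step show ?case by (simp add: harm_Suc algebra_simps add_divide_distrib)
  qed simp
next
  case False
  then have "l \<le> m" by simp
  then show ?thesis
  proof (induction l rule: inc_induct)
    case (step n)
    have "1 / (real m + 1) \<le> inverse (real (Suc n))"
      using step by (simp add: field_simps)
    with step show ?case by (simp add: harm_Suc algebra_simps add_divide_distrib)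
  qed simp
qed

lemma harm_eq_chord:
  "l = m \<or> l = Suc m \<Longrightarrow> harm l = harm m - real m / (real m + 1) + 1 / (real m + 1) * real l"
proof -
  have "inverse (real (Suc m)) = 1 / (real m + 1) * real (Suc m) - real m / (real m + 1)"
    by (simp add: field_simps)
  then show "l = m \<or> l = Suc m \<Longrightarrow> ?thesis"
    unfolding harm_Suc by (auto simp only: harm_Suc) simp_all
qed

lemma balanced_blocks:
  assumes m: "m \<ge> 1" and N: "k * m \<le> N" "N \<le> k * Suc m"
  obtains c where "blocks k N c"
    "\<And>j. c (Suc j) - c j = m \<or> c (Suc j) - c j = Suc m"
proof
  \<comment> \<open>The first \<open>N - k * m\<close> blocks get length \<open>Suc m\<close>, the
    others \<open>m\<close>.\<close>
  let ?c = "\<lambda>j. m * j + min j (N - k * m)"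
  show "blocks k N ?c" using assms by (auto simp: blocks_def mult.commute)
  show "?c (Suc j) - ?c j = m \<or> ?c (Suc j) - ?c j = Suc m" for j by (auto simp: min_def)
qed

text \<open>Both bounds differ from the limit by \<alpha> / N: the upper one from the extra block,
  the lower one from rounding \<open>N * \<epsilon>\<close> down. Blocks of lengths \<open>m\<close>
  and \<open>Suc m\<close> lose nothing, since the line touches \<open>harm\<close> there.\<close>

lemma tendsto_minimax_mono:
  fixes \<epsilon> :: real
  assumes \<epsilon>: "0 < \<epsilon>"
    and line: "\<And>l. harm l \<le> \<alpha> + \<beta> * real l" and nonneg: "\<alpha> \<ge> 0" "\<beta> \<ge> 0"
    and m: "m \<ge> 1" "m \<le> 1 / \<epsilon>" "1 / \<epsilon> < Suc m"
    and touch: "harm m = \<alpha> + \<beta> * real m" "harm (Suc m) = \<alpha> + \<beta> * real (Suc m)"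
  shows "(\<lambda>N. minimax_mono N \<epsilon>) \<longlonglongrightarrow> ennreal (\<alpha> * \<epsilon> + \<beta>)"
proof (rule tendsto_sandwich)
  show "(\<lambda>N. ennreal (\<alpha> * (\<epsilon> - 1 / real N) + \<beta>)) \<longlonglongrightarrow> ennreal (\<alpha> * \<epsilon> + \<beta>)"
    by (rule tendsto_ennrealI) (auto intro!: tendsto_eq_intros lim_1_over_n)
  show "(\<lambda>N. ennreal (\<alpha> * (\<epsilon> + 1 / real N) + \<beta>)) \<longlonglongrightarrow> ennreal (\<alpha> * \<epsilon> + \<beta>)"
    by (rule tendsto_ennrealI) (auto intro!: tendsto_eq_intros lim_1_over_n)
  show "\<forall>\<^sub>F N in sequentially. minimax_mono N \<epsilon> \<le> ennreal (\<alpha> * (\<epsilon> + 1 / real N) + \<beta>)"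
    using eventually_ge_at_top[of 1]
  proof eventually_elim
    case (elim N)
    have "(SUP \<nu>\<in>F_mono N \<epsilon>. risk_mono N \<nu>) \<le> ennreal (\<alpha> * (N * \<epsilon> + 1) + \<beta> * N)"
      using \<epsilon> by (intro SUP_least risk_mono_le elim line nonneg) auto
    then have "minimax_mono N \<epsilon> \<le> ennreal (\<alpha> * (N * \<epsilon> + 1) + \<beta> * N) / ennreal N"
      unfolding minimax_mono_def by (rule divide_right_mono_ennreal)
    also have "\<dots> = ennreal ((\<alpha> * (N * \<epsilon> + 1) + \<beta> * N) / N)"
      using nonneg \<epsilon> elim by (intro divide_ennreal) auto
    also have "(\<alpha> * (N * \<epsilon> + 1) + \<beta> * N) / N = \<alpha> * (\<epsilon> + 1 / real N) + \<beta>"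
      using elim by (simp add: field_simps)
    finally show ?case .
  qed
  have gap: "\<epsilon> * Suc m - 1 > 0" using m \<epsilon> by (simp add: field_simps)
  \<comment> \<open>From \<open>N0\<close> on, \<open>N \<le> (N * \<epsilon> - 1) * Suc m\<close>,
    so the rounded number of blocks can still cover all \<open>N\<close> indices; this uses the
    strict inequality \<open>1 / \<epsilon> < Suc m\<close>.\<close>
  obtain N0 :: nat where N0: "Suc m / (\<epsilon> * Suc m - 1) \<le> N0" using real_arch_simple by blast
  show "\<forall>\<^sub>F N in sequentially. ennreal (\<alpha> * (\<epsilon> - 1 / real N) + \<beta>) \<le> minimax_mono N \<epsilon>"
    using eventually_ge_at_top[of "max 1 N0"]
  proof eventually_elim
    case (elim N)
    \<comment> \<open>These \<open>k\<close> blocks create at most \<open>k - 1\<close> jumps,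
      within the budget, and \<open>m \<le> 1 / \<epsilon>\<close> gives
      \<open>k * m \<le> N\<close>.\<close>
    define k where "k = nat \<lfloor>N * \<epsilon>\<rfloor>"
    have k: "real k \<le> N * \<epsilon>" "N * \<epsilon> - 1 \<le> real k"
      using \<epsilon> unfolding k_def by (auto simp: of_nat_nat)
    have "real (k * m) \<le> (N * \<epsilon>) * (1 / \<epsilon>)"
      unfolding of_nat_mult using k m \<epsilon> by (intro mult_mono) auto
    then have "real (k * m) \<le> real N" using \<epsilon> by simp
    then have 1: "k * m \<le> N" by linarith
    have "Suc m / (\<epsilon> * Suc m - 1) \<le> N" using N0 elim by linarith
    then have "real N \<le> (N * \<epsilon> - 1) * Suc m" using gap by (simp add: pos_divide_le_eq algebra_simps)
    also have "\<dots> \<le> real k * Suc m" using k by (intro mult_right_mono) auto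
    finally have "real N \<le> real (k * Suc m)" by (simp only: of_nat_mult)
    then have 2: "N \<le> k * Suc m" by linarith
    obtain c where b: "blocks k N c" and l: "\<And>j. c (Suc j) - c j = m \<or> c (Suc j) - c j = Suc m"
      using balanced_blocks[OF m(1) 1 2] by blast
    have "\<alpha> * k + \<beta> * N = (\<Sum>j<k. \<alpha> + \<beta> * real (c (Suc j) - c j))"
      using blocks_sum_length[OF b] by (simp add: sum.distrib flip: sum_distrib_left of_nat_sum)
    also have "\<dots> = (\<Sum>j<k. harm (c (Suc j) - c j))"
      using l touch by (intro sum.cong refl) metis
    also have "ennreal \<dots> \<le> (SUP \<nu>\<in>F_mono N \<epsilon>. risk_mono N \<nu>)"
      by (rule SUP_risk_mono_ge[OF b]) (use k in linarith)
    finally have "ennreal (\<alpha> * k + \<beta> * N) / ennreal N \<le> minimax_mono N \<epsilon>"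
      unfolding minimax_mono_def by (rule divide_right_mono_ennreal)
    moreover have "ennreal (\<alpha> * k + \<beta> * N) / ennreal N = ennreal ((\<alpha> * k + \<beta> * N) / N)"
      using nonneg elim by (intro divide_ennreal) auto
    moreover have "\<alpha> * (\<epsilon> - 1 / real N) + \<beta> \<le> (\<alpha> * k + \<beta> * N) / N"
    proof -
      have "\<alpha> * (N * \<epsilon> - 1) \<le> \<alpha> * k" using k nonneg by (intro mult_left_mono) auto
      then have "(\<alpha> * (N * \<epsilon> - 1) + \<beta> * N) / N \<le> (\<alpha> * k + \<beta> * N) / N"
        by (intro divide_right_mono) auto
      moreover have "(\<alpha> * (N * \<epsilon> - 1) + \<beta> * N) / N = \<alpha> * (\<epsilon> - 1 / real N) + \<beta>"
        using elim by (simp add: field_simps)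
      ultimately show ?thesis by simp
    qed
    ultimately show ?case by (metis ennreal_leI order_trans)
  qed
qed

text \<open>Summing the affine majorant against \<pi> involves only its mass 1 and its mean
  \<open>1 / \<epsilon>\<close>, so the bound is the same for every feasible \<pi>.\<close>

lemma feasible_pi_bound:
  assumes f: "feasible_pi \<epsilon> \<pi>" and line: "\<And>l. r_mono l \<le> \<alpha> + \<beta> * real l"
  shows "(\<lambda>l. \<pi> l * r_mono l) summable_on UNIV"
    and "(\<Sum>\<^sub>\<infinity>l. \<pi> l * r_mono l) \<le> \<alpha> + \<beta> / \<epsilon>"
proof -
  have pos: "0 \<le> \<pi> l" for l using f by (simp add: feasible_pi_def)
  have nn: "0 \<le> \<pi> l * r_mono l" for l using pos by (simp add: r_mono_eq_harm harm_nonneg)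
  have le: "\<pi> l * r_mono l \<le> \<alpha> * \<pi> l + \<beta> * (real l * \<pi> l)" for l
    using mult_left_mono[OF line[of l] pos[of l]] by (simp add: algebra_simps)
  have s: "(\<lambda>l. \<alpha> * \<pi> l + \<beta> * (real l * \<pi> l)) sums (\<alpha> * 1 + \<beta> * (1 / \<epsilon>))"
    using f unfolding feasible_pi_def by (intro sums_add sums_mult) auto
  have sm: "summable (\<lambda>l. \<pi> l * r_mono l)"
    by (rule summable_comparison_test'[OF sums_summable[OF s], of 0]) (use nn le in auto)
  then show son: "(\<lambda>l. \<pi> l * r_mono l) summable_on UNIV"
    using nn by (simp add: summable_on_UNIV_nonneg_real_iff)
  have "(\<lambda>l. \<pi> l * r_mono l) sums (\<Sum>\<^sub>\<infinity>l. \<pi> l * r_mono l)"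
    using son by (intro has_sum_imp_sums) simp
  from sums_le[OF le this s] show "(\<Sum>\<^sub>\<infinity>l. \<pi> l * r_mono l) \<le> \<alpha> + \<beta> / \<epsilon>" by simp
qed

lemma two_point_distribution:
  assumes m: "m \<ge> 1" "real m \<le> 1 / \<epsilon>" "1 / \<epsilon> < Suc m"
    and touch: "r_mono m = \<alpha> + \<beta> * real m" "r_mono (Suc m) = \<alpha> + \<beta> * real (Suc m)"
  obtains \<pi> where "feasible_pi \<epsilon> \<pi>" "(\<Sum>\<^sub>\<infinity>l. \<pi> l * r_mono l) = \<alpha> + \<beta> / \<epsilon>"
proof
  \<comment> \<open>The weights on \<open>m\<close> and \<open>Suc m\<close> are forced by mass 1
    and mean \<open>1 / \<epsilon>\<close>. The majorant is exact on this support, so its bound is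
    attained.\<close>
  define \<pi> where "\<pi> l = (if l = m then Suc m - 1 / \<epsilon> else if l = Suc m then 1 / \<epsilon> - m else 0)" for l
  have "\<pi> sums (\<Sum>l\<in>{m, Suc m}. \<pi> l)"
    by (rule sums_finite) (auto simp: \<pi>_def)
  moreover have "(\<lambda>l. real l * \<pi> l) sums (\<Sum>l\<in>{m, Suc m}. real l * \<pi> l)"
    by (rule sums_finite) (auto simp: \<pi>_def)
  ultimately show "feasible_pi \<epsilon> \<pi>"
    using m by (auto simp: feasible_pi_def \<pi>_def algebra_simps)
  have "(\<Sum>\<^sub>\<infinity>l. \<pi> l * r_mono l) = (\<Sum>\<^sub>\<infinity>l\<in>{m, Suc m}. \<pi> l * r_mono l)"
    by (rule infsum_cong_neutral) (auto simp: \<pi>_def)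
  also have "\<dots> = \<alpha> + \<beta> / \<epsilon>"
    by (simp add: \<pi>_def touch algebra_simps)
  finally show "(\<Sum>\<^sub>\<infinity>l. \<pi> l * r_mono l) = \<alpha> + \<beta> / \<epsilon>" .
qed

text \<open>The line is itself a concave majorant, and any concave majorant lies above the chord
  over \<open>[m, m + 1]\<close>, which contains \<open>x\<close>.\<close>

lemma r_hat_eq_chord:
  assumes m: "m \<ge> 1" "real m \<le> x" "x < Suc m"
    and line: "\<And>l. r_mono l \<le> \<alpha> + \<beta> * real l"
    and touch: "r_mono m = \<alpha> + \<beta> * real m" "r_mono (Suc m) = \<alpha> + \<beta> * real (Suc m)"
  shows "r_hat x = \<alpha> + \<beta> * x"
  unfolding r_hat_def
proof (rule cInf_eq_minimum)
  have "concave_on {1..} (\<lambda>x::real. \<alpha> + \<beta> * x)"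
    unfolding concave_on_iff
  proof (intro conjI ballI allI impI)
    fix x y u v :: real assume "u + v = 1"
    then have "u * \<alpha> + v * \<alpha> = \<alpha>" by (simp flip: distrib_right)
    then show "u * (\<alpha> + \<beta> * x) + v * (\<alpha> + \<beta> * y) \<le> \<alpha> + \<beta> * (u *\<^sub>R x + v *\<^sub>R y)"
      by (simp add: algebra_simps)
  qed (rule convex_real_interval)
  then show "\<alpha> + \<beta> * x \<in> {g x |g. concave_on {1..} g \<and> (\<forall>l::nat. 1 \<le> l \<longrightarrow> r_mono l \<le> g (real l))}"
    using line by (intro CollectI exI[of _ "\<lambda>x. \<alpha> + \<beta> * x"]) auto
next
  fix a assume "a \<in> {g x |g. concave_on {1..} g \<and> (\<forall>l::nat. 1 \<le> l \<longrightarrow> r_mono l \<le> g (real l))}"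
  then obtain g where a: "a = g x" and conc: "concave_on {1..} g"
    and maj: "\<And>l::nat. 1 \<le> l \<Longrightarrow> r_mono l \<le> g (real l)" by auto
  define t where "t = x - m"
  have t: "0 \<le> t" "t \<le> 1" using m by (auto simp: t_def)
  have "\<alpha> + \<beta> * x = (1 - t) * r_mono m + t * r_mono (Suc m)"
    unfolding touch t_def by (simp add: algebra_simps)
  also have "\<dots> \<le> (1 - t) * g (real m) + t * g (real (Suc m))"
    using t m by (intro add_mono mult_left_mono maj) auto
  also have "\<dots> \<le> g ((1 - t) *\<^sub>R real m + t *\<^sub>R real (Suc m))"
    using t m by (intro concave_onD[OF conc]) auto
  also have "(1 - t) *\<^sub>R real m + t *\<^sub>R real (Suc m) = x"
    by (simp add: t_def algebra_simps)
  finally show "\<alpha> + \<beta> * x \<le> a" by (simp add: a)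
qed

theorem mainTheorem11:
  shows "(\<forall>\<epsilon>::real. 0 < \<epsilon> \<and> \<epsilon> < 1 \<longrightarrow>
           (\<exists>L::real. (\<lambda>N. minimax_mono N \<epsilon>) \<longlonglongrightarrow> ennreal L \<and>
              (\<exists>\<pi>. feasible_pi \<epsilon> \<pi> \<and> (\<lambda>l. \<pi> l * r_mono l) summable_on UNIV \<and>
                    L = \<epsilon> * (\<Sum>\<^sub>\<infinity>l. \<pi> l * r_mono l)) \<and>
              (\<forall>\<pi>. feasible_pi \<epsilon> \<pi> \<longrightarrow> (\<lambda>l. \<pi> l * r_mono l) summable_on UNIV \<and>
                    \<epsilon> * (\<Sum>\<^sub>\<infinity>l. \<pi> l * r_mono l) \<le> L) \<and>
              L / \<epsilon> = r_hat (1 / \<epsilon>)))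
       \<and> (\<exists>\<epsilon>0>0. \<forall>\<epsilon>::real. 0 < \<epsilon> \<and> \<epsilon> \<le> \<epsilon>0 \<and> \<epsilon> < 1 \<longrightarrow>
           (\<forall>L::real. (\<lambda>N. minimax_mono N \<epsilon>) \<longlonglongrightarrow> ennreal L \<longrightarrow>
              L \<le> 20 * \<epsilon> * (ln (1 / \<epsilon>))\<^sup>2))"
proof -
  define m where "m \<epsilon> = nat \<lfloor>1 / \<epsilon>\<rfloor>" for \<epsilon> :: real
  define \<alpha> where "\<alpha> \<epsilon> = harm (m \<epsilon>) - real (m \<epsilon>) / (real (m \<epsilon>) + 1)" for \<epsilon>
  define \<beta> where "\<beta> \<epsilon> = 1 / (real (m \<epsilon>) + 1)" for \<epsilon>
  have line: "harm l \<le> \<alpha> \<epsilon> + \<beta> \<epsilon> * real l" for l \<epsilon>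
    unfolding \<alpha>_def \<beta>_def by (rule harm_le_chord)
  have touch: "harm (m \<epsilon>) = \<alpha> \<epsilon> + \<beta> \<epsilon> * real (m \<epsilon>)"
    "harm (Suc (m \<epsilon>)) = \<alpha> \<epsilon> + \<beta> \<epsilon> * real (Suc (m \<epsilon>))" for \<epsilon>
    unfolding \<alpha>_def \<beta>_def by (rule harm_eq_chord, simp)+
  have nonneg: "\<alpha> \<epsilon> \<ge> 0" "\<beta> \<epsilon> \<ge> 0" for \<epsilon>
    \<comment> \<open>At length 0 the majorant bound reads
      \<open>0 \<le> \<alpha> \<epsilon>\<close>.\<close>
    using line[of 0 \<epsilon>] by (simp_all add: harm_def \<beta>_def)
  have m: "m \<epsilon> \<ge> 1" "real (m \<epsilon>) \<le> 1 / \<epsilon>" "1 / \<epsilon> < Suc (m \<epsilon>)" if "0 < \<epsilon>" "\<epsilon> < 1" for \<epsilon>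
  proof -
    have "1 / \<epsilon> > 1" using that by simp
    then have "\<lfloor>1 / \<epsilon>\<rfloor> \<ge> 1" by (simp add: le_floor_iff)
    then show "m \<epsilon> \<ge> 1" "real (m \<epsilon>) \<le> 1 / \<epsilon>" "1 / \<epsilon> < Suc (m \<epsilon>)"
      unfolding m_def by (auto simp: of_nat_nat) linarith+
  qed
  have lim: "(\<lambda>N. minimax_mono N \<epsilon>) \<longlonglongrightarrow> ennreal (\<alpha> \<epsilon> * \<epsilon> + \<beta> \<epsilon>)" if "0 < \<epsilon>" "\<epsilon> < 1" for \<epsilon>
    by (rule tendsto_minimax_mono[OF that(1) line nonneg m[OF that] touch])
  show ?thesis
  proof (intro conjI allI impI)
    fix \<epsilon> :: real assume "0 < \<epsilon> \<and> \<epsilon> < 1"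
    then have \<epsilon>: "0 < \<epsilon>" "\<epsilon> < 1" by auto
    define L where "L = \<alpha> \<epsilon> * \<epsilon> + \<beta> \<epsilon>"
    \<comment> \<open>The limit is \<epsilon> times the chord's value at
      \<open>1 / \<epsilon>\<close>, the form shared by the maximum over \<pi> and by
      \<open>r_hat\<close>.\<close>
    have L: "L = \<epsilon> * (\<alpha> \<epsilon> + \<beta> \<epsilon> / \<epsilon>)" using \<epsilon> by (simp add: L_def field_simps)
    note line' = line[of _ \<epsilon>, folded r_mono_eq_harm]
    note touch' = touch[of \<epsilon>, folded r_mono_eq_harm]
    obtain \<pi> where \<pi>: "feasible_pi \<epsilon> \<pi>" "(\<Sum>\<^sub>\<infinity>l. \<pi> l * r_mono l) = \<alpha> \<epsilon> + \<beta> \<epsilon> / \<epsilon>"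
      using two_point_distribution[OF m[OF \<epsilon>] touch'] .
    show "\<exists>L::real. (\<lambda>N. minimax_mono N \<epsilon>) \<longlonglongrightarrow> ennreal L \<and>
              (\<exists>\<pi>. feasible_pi \<epsilon> \<pi> \<and> (\<lambda>l. \<pi> l * r_mono l) summable_on UNIV \<and>
                    L = \<epsilon> * (\<Sum>\<^sub>\<infinity>l. \<pi> l * r_mono l)) \<and>
              (\<forall>\<pi>. feasible_pi \<epsilon> \<pi> \<longrightarrow> (\<lambda>l. \<pi> l * r_mono l) summable_on UNIV \<and>
                    \<epsilon> * (\<Sum>\<^sub>\<infinity>l. \<pi> l * r_mono l) \<le> L) \<and>
              L / \<epsilon> = r_hat (1 / \<epsilon>)"
    proof (intro exI[of _ L] conjI allI impI)
      show "(\<lambda>N. minimax_mono N \<epsilon>) \<longlonglongrightarrow> ennreal L" unfolding L_def by (rule lim[OF \<epsilon>])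
      show "\<exists>\<pi>. feasible_pi \<epsilon> \<pi> \<and> (\<lambda>l. \<pi> l * r_mono l) summable_on UNIV \<and>
                    L = \<epsilon> * (\<Sum>\<^sub>\<infinity>l. \<pi> l * r_mono l)"
        using \<pi> feasible_pi_bound(1)[OF \<pi>(1) line'] L by auto
      show "L / \<epsilon> = r_hat (1 / \<epsilon>)"
        using r_hat_eq_chord[OF m[OF \<epsilon>] line' touch'] \<epsilon> L by simp
    next
      fix \<pi> assume f: "feasible_pi \<epsilon> \<pi>"
      show "(\<lambda>l. \<pi> l * r_mono l) summable_on UNIV" by (rule feasible_pi_bound(1)[OF f line'])
      show "\<epsilon> * (\<Sum>\<^sub>\<infinity>l. \<pi> l * r_mono l) \<le> L"
        unfolding L using \<epsilon> by (intro mult_left_mono feasible_pi_bound(2)[OF f line']) auto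
    qed
  next
    show "\<exists>\<epsilon>0>0. \<forall>\<epsilon>::real. 0 < \<epsilon> \<and> \<epsilon> \<le> \<epsilon>0 \<and> \<epsilon> < 1 \<longrightarrow>
           (\<forall>L::real. (\<lambda>N. minimax_mono N \<epsilon>) \<longlonglongrightarrow> ennreal L \<longrightarrow>
              L \<le> 20 * \<epsilon> * (ln (1 / \<epsilon>))\<^sup>2)"
    \<comment> \<open>This threshold makes \<open>ln (1 / \<epsilon>)\<close> at least 1, so that
      its square dominates both it and the constants.\<close>
    proof (intro exI[of _ "exp (-1)"] conjI allI impI)
      fix \<epsilon> L :: real
      assume "0 < \<epsilon> \<and> \<epsilon> \<le> exp (-1) \<and> \<epsilon> < 1" and L: "(\<lambda>N. minimax_mono N \<epsilon>) \<longlonglongrightarrow> ennreal L"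
      then have \<epsilon>: "0 < \<epsilon>" "\<epsilon> < 1" and small: "\<epsilon> \<le> exp (-1)" by auto
      define u where "u = ln (1 / \<epsilon>)"
      have "exp 1 \<le> 1 / \<epsilon>" using small \<epsilon> by (simp add: exp_minus field_simps)
      then have u: "u \<ge> 1" using \<epsilon> by (simp add: u_def ln_ge_iff)
      have "ennreal L = ennreal (\<alpha> \<epsilon> * \<epsilon> + \<beta> \<epsilon>)" by (rule LIMSEQ_unique[OF L lim[OF \<epsilon>]])
      then have "L \<le> \<alpha> \<epsilon> * \<epsilon> + \<beta> \<epsilon>"
        \<comment> \<open>\<open>ennreal\<close> truncates negative reals to 0; the comparison
          passes back to reals because the right-hand side is nonnegative.\<close>
        using nonneg[of \<epsilon>] \<epsilon> ennreal_le_iff[of "\<alpha> \<epsilon> * \<epsilon> + \<beta> \<epsilon>" L] by simp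
      also have "\<dots> = \<epsilon> * (\<alpha> \<epsilon> + \<beta> \<epsilon> * (1 / \<epsilon>))" using \<epsilon> by (simp add: field_simps)
      \<comment> \<open>The chord increases, so its value at \<open>1 / \<epsilon>\<close> is at
        most that at its right end \<open>Suc (m \<epsilon>)\<close>.\<close>
      also have "\<dots> \<le> \<epsilon> * (\<alpha> \<epsilon> + \<beta> \<epsilon> * Suc (m \<epsilon>))"
        using \<epsilon> m[OF \<epsilon>] nonneg by (intro mult_left_mono add_left_mono) auto
      also have "\<alpha> \<epsilon> + \<beta> \<epsilon> * Suc (m \<epsilon>) = harm (Suc (m \<epsilon>))" by (simp only: touch)
      also have "harm (Suc (m \<epsilon>)) \<le> harm (m \<epsilon>) + (1::real)"
        by (simp add: harm_Suc field_simps)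
      \<comment> \<open>The sequence \<open>harm n - ln n\<close> decreases from its value 1 at
        \<open>n = 1\<close>.\<close>
      also have "harm (m \<epsilon>) \<le> 1 + ln (real (m \<epsilon>))"
        using euler_mascheroni_sequence_decreasing[of 1 "m \<epsilon>"] m[OF \<epsilon>] by (simp add: harm_def)
      also have "ln (real (m \<epsilon>)) \<le> u"
        unfolding u_def using m[OF \<epsilon>] by (intro ln_mono) auto
      also have "1 + u + 1 \<le> 20 * u\<^sup>2"
        using u self_le_power[OF u, of 2] by simp
      finally show "L \<le> 20 * \<epsilon> * (ln (1 / \<epsilon>))\<^sup>2" using \<epsilon> by (simp add: u_def mult_ac)
    qed simp
  qed
qed

end
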